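(* Let $r \in (0,1)$ be fixed and consider Babenko's equation for waves on water of finite depth $$\mathcal{F}(\mu, v) = 0, \qquad (\mu, v) \in \mathbb{R} \times \hat H_0,$$ where $\mathcal{F} : \mathbb{R} \times \hat H_0 \to L^2(-\pi,\pi)$ is given by $$\mathcal{F}(\mu, v) = \mu\, \mathcal{B}_r(v') - v - v\, \mathcal{B}_r(v') - \mathcal{B}_r(v' v),$$ that is, the equation $\mu\, \mathcal{B}_r(v') = v + v\, \mathcal{B}_r(v') + \mathcal{B}_r(v' v)$ on $(-\pi,\pi)$. For $n = 1,2,\dots$ put $$\mu_n = \frac{1 - r^{2n}}{n\,(1 + r^{2n})}.$$ Then for every $n = 1,2,\dots$ there exists $\varepsilon_n > 0$ such that for $0 < |s| < \varepsilon_n$ there is a family $\big(\mu_n^{(s)}, v_n^{(s)}\big) \in \mathbb{R} \times \hat H_0$ of (Stokes-wave) solutions of the equation $\mathcal{F}(\mu, v) = 0$. Together with the bifurcation point $(\mu_n, 0)$ (corresponding to $s = 0$), the points of this family form the continuous curve $$C_n = \big\{ \big(\mu_n^{(s)}, v_n^{(s)}\big) : |s| < \varepsilon_n \big\} \subset \mathbb{R} \times \hat H_0 .$$ Moreover, the asymptotic formulae $$\mu_n^{(s)} = \mu_n + o(s), \qquad v_n^{(s)}(t) = s \cos nt + o(s)$$ hold for these solutions as $|s| \to 0$ (the second one in $\hat H_0$). Finally, each curve $C_n$ is of class $C^1$.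
   Context: All functions are real-valued, and $'$ denotes differentiation with respect to $t$. $H_0$ is the Sobolev space of functions $v$ that are absolutely continuous on $[-\pi,\pi]$, satisfy $v(-\pi) = v(\pi)$, and have weak derivative $v' \in L^2(-\pi,\pi)$ (with the usual $W^{1,2}$ norm). $\hat H_0$ is the subspace of $H_0$ consisting of even functions. For $r \in (0,1)$, $\mathcal{B}_r$ is the bounded linear operator on $L^2(-\pi,\pi)$ defined by linearity (and continuity) from $$\mathcal{B}_r(\cos nt) = \frac{1 + r^{2n}}{1 - r^{2n}} \sin nt, \qquad \mathcal{B}_r(\sin nt) = -\frac{1 + r^{2n}}{1 - r^{2n}} \cos nt, \qquad n \geq 1,$$ and $\mathcal{B}_r(1) = 0$. The term "Stokes-wave solutions" is only the name given to the solutions on these branches bifurcating from the zero solution. *)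

theory Defs
  imports "HOL-Analysis.Analysis" "HOL-Library.Landau_Symbols"
begin

abbreviation leb_pi :: "real measure" where
  "leb_pi \<equiv> lebesgue_on {-pi<..<pi}"

definition square_integrable :: "(real \<Rightarrow> real) \<Rightarrow> bool" where
  "square_integrable f \<longleftrightarrow>
     f \<in> borel_measurable leb_pi \<and> integrable leb_pi (\<lambda>t. (f t)\<^sup>2)"

lemma finite_leb_pi: "finite_measure leb_pi"
  by (rule finite_measure_lebesgue_on) (simp add: lmeasurable_interval)

lemma square_integrable_imp_integrable:
  "square_integrable f \<Longrightarrow> integrable leb_pi f"
  using finite_measure.square_integrable_imp_integrable[OF finite_leb_pi]
  unfolding square_integrable_def by blast

lemma square_integrable_mult:
  assumes "square_integrable f" "square_integrable g"
  shows "integrable leb_pi (\<lambda>t. f t * g t)"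
proof (rule Bochner_Integration.integrable_bound)
  show "integrable leb_pi (\<lambda>t. (f t)\<^sup>2 + (g t)\<^sup>2)"
    using assms unfolding square_integrable_def by auto
  show "(\<lambda>t. f t * g t) \<in> borel_measurable leb_pi"
    using assms unfolding square_integrable_def by auto
  have "\<bar>x * y\<bar> \<le> x\<^sup>2 + y\<^sup>2" for x y :: real
  proof -
    have "0 \<le> (\<bar>x\<bar> - \<bar>y\<bar>)\<^sup>2" by simp
    then have "2 * (\<bar>x\<bar> * \<bar>y\<bar>) \<le> x\<^sup>2 + y\<^sup>2"
      by (simp add: power2_diff)
    moreover have "0 \<le> \<bar>x\<bar> * \<bar>y\<bar>" by simp
    ultimately show ?thesis unfolding abs_mult by linarith
  qed
  then show "AE t in leb_pi. norm (f t * g t) \<le> norm ((f t)\<^sup>2 + (g t)\<^sup>2)"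
    by (intro AE_I2) (simp add: abs_of_nonneg)
qed

lemma square_integrable_zero: "square_integrable (\<lambda>_. 0)"
  unfolding square_integrable_def by simp

lemma square_integrable_add:
  assumes "square_integrable f" "square_integrable g"
  shows "square_integrable (\<lambda>t. f t + g t)"
proof -
  have "integrable leb_pi (\<lambda>t. (f t)\<^sup>2 + (g t)\<^sup>2 + 2 * (f t * g t))"
    using assms square_integrable_mult[OF assms] unfolding square_integrable_def by auto
  then show ?thesis
    using assms unfolding square_integrable_def by (auto simp: power2_sum algebra_simps)
qed

lemma square_integrable_scale:
  assumes "square_integrable f"
  shows "square_integrable (\<lambda>t. c * f t)"
  using assms unfolding square_integrable_def by (auto simp: power_mult_distrib)

lemma square_integrable_minus:
  "square_integrable f \<Longrightarrow> square_integrable (\<lambda>t. - f t)"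
  using square_integrable_scale[of f "-1"] by simp

lemma square_integrable_diff:
  "square_integrable f \<Longrightarrow> square_integrable g \<Longrightarrow> square_integrable (\<lambda>t. f t - g t)"
  using square_integrable_add[of f "\<lambda>t. - g t"] square_integrable_minus[of g] by simp

lemma square_integrable_bounded_mult:
  assumes "v \<in> borel_measurable leb_pi" "\<And>t. t \<in> {-pi<..<pi} \<Longrightarrow> \<bar>v t\<bar> \<le> C"
    and "square_integrable w"
  shows "square_integrable (\<lambda>t. v t * w t)"
  unfolding square_integrable_def
proof
  show meas: "(\<lambda>t. v t * w t) \<in> borel_measurable leb_pi"
    using assms unfolding square_integrable_def by auto
  show "integrable leb_pi (\<lambda>t. (v t * w t)\<^sup>2)"
  proof (rule Bochner_Integration.integrable_bound)
    show "integrable leb_pi (\<lambda>t. C\<^sup>2 * (w t)\<^sup>2)"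
      using assms unfolding square_integrable_def by auto
    show "(\<lambda>t. (v t * w t)\<^sup>2) \<in> borel_measurable leb_pi"
      using meas by auto
    have "(v t)\<^sup>2 \<le> C\<^sup>2" if "t \<in> {-pi<..<pi}" for t
      using assms(2)[OF that] by (metis abs_ge_zero power2_abs power_mono)
    then show "AE t in leb_pi. norm ((v t * w t)\<^sup>2) \<le> norm (C\<^sup>2 * (w t)\<^sup>2)"
      by (intro AE_I2) (auto simp: power_mult_distrib intro!: mult_right_mono)
  qed
qed

lemma square_integrable_bounded:
  assumes "v \<in> borel_measurable leb_pi" "\<And>t. t \<in> {-pi<..<pi} \<Longrightarrow> \<bar>v t\<bar> \<le> C"
  shows "square_integrable v"
proof -
  have "square_integrable (\<lambda>_. 1)"
    using finite_measure.integrable_const[OF finite_leb_pi]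
    unfolding square_integrable_def by simp
  from square_integrable_bounded_mult[OF assms this] show ?thesis by simp
qed

lemma square_integrable_continuous:
  assumes "continuous_on {-pi..pi} v"
  shows "square_integrable v"
proof -
  have "compact (v ` {-pi..pi})"
    by (intro compact_continuous_image assms) simp
  then obtain C where "\<And>t. t \<in> {-pi..pi} \<Longrightarrow> \<bar>v t\<bar> \<le> C"
    using compact_imp_bounded bounded_iff by (metis imageI real_norm_def)
  moreover have "v \<in> borel_measurable leb_pi"
    by (intro continuous_imp_measurable_on_sets_lebesgue continuous_on_subset[OF assms]) auto
  ultimately show ?thesis by (intro square_integrable_bounded[of v C]) auto
qed

definition L2_rel :: "(real \<Rightarrow> real) \<Rightarrow> (real \<Rightarrow> real) \<Rightarrow> bool" where
  "L2_rel f g \<longleftrightarrow> square_integrable f \<and> square_integrable g \<and> (AE t in leb_pi. f t = g t)"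

lemma L2_rel_eqI:
  assumes "square_integrable f" "square_integrable g" "\<And>t. f t = g t"
  shows "L2_rel f g"
  using assms unfolding L2_rel_def by simp

lemma AE_eq_binop:
  assumes "AE t in M. f t = f' t" "AE t in M. g t = g' t"
  shows "AE t in M. h (f t) (g t) = h (f' t) (g' t)"
  using assms by eventually_elim simp

quotient_type L2 = "real \<Rightarrow> real" / partial: L2_rel
  morphisms rep_L2 abs_L2
proof (rule part_equivpI)
  have "square_integrable (\<lambda>_. 0)"
    unfolding square_integrable_def by simp
  then show "\<exists>f. L2_rel f f" unfolding L2_rel_def by auto
  show "symp L2_rel" unfolding L2_rel_def by (auto intro!: sympI)
  show "transp L2_rel"
  proof (rule transpI)
    fix f g h assume "L2_rel f g" "L2_rel g h"
    then have "AE t in leb_pi. f t = g t" "AE t in leb_pi. g t = h t"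
      unfolding L2_rel_def by auto
    then have "AE t in leb_pi. f t = h t" by eventually_elim simp
    with \<open>L2_rel f g\<close> \<open>L2_rel g h\<close> show "L2_rel f h"
      unfolding L2_rel_def by blast
  qed
qed

instantiation L2 :: real_vector
begin

lift_definition zero_L2 :: L2 is "\<lambda>_. 0"
  unfolding L2_rel_def square_integrable_def by simp

lift_definition plus_L2 :: "L2 \<Rightarrow> L2 \<Rightarrow> L2" is "\<lambda>f g t. f t + g t"
  unfolding L2_rel_def using AE_eq_binop[where h = "(+)"] square_integrable_add by blast

lift_definition uminus_L2 :: "L2 \<Rightarrow> L2" is "\<lambda>f t. - f t"
  unfolding L2_rel_def by (auto intro!: square_integrable_minus)

lift_definition minus_L2 :: "L2 \<Rightarrow> L2 \<Rightarrow> L2" is "\<lambda>f g t. f t - g t"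
  unfolding L2_rel_def using AE_eq_binop[where h = "(-)"] square_integrable_diff by blast

lift_definition scaleR_L2 :: "real \<Rightarrow> L2 \<Rightarrow> L2" is "\<lambda>c f t. c * f t"
  unfolding L2_rel_def by (auto intro!: square_integrable_scale)

instance
proof
  fix f g h :: L2 and a b :: real
  show "f + g + h = f + (g + h)"
    by transfer (intro L2_rel_eqI square_integrable_add; (simp add: L2_rel_def)?)
  show "f + g = g + f"
    by transfer (intro L2_rel_eqI square_integrable_add; (simp add: L2_rel_def)?)
  show "0 + f = f"
    by transfer simp
  show "- f + f = 0"
    by transfer (intro L2_rel_eqI square_integrable_add square_integrable_minus square_integrable_zero;
        (simp add: L2_rel_def)?)
  show "f - g = f + - g"
    by transfer (intro L2_rel_eqI square_integrable_add square_integrable_diff square_integrable_minus;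
        (simp add: L2_rel_def)?)
  show "a *\<^sub>R (f + g) = a *\<^sub>R f + a *\<^sub>R g"
    by transfer (intro L2_rel_eqI square_integrable_add square_integrable_scale;
        (simp add: L2_rel_def algebra_simps)?)
  show "(a + b) *\<^sub>R f = a *\<^sub>R f + b *\<^sub>R f"
    by transfer (intro L2_rel_eqI square_integrable_add square_integrable_scale;
        (simp add: L2_rel_def algebra_simps)?)
  show "a *\<^sub>R b *\<^sub>R f = (a * b) *\<^sub>R f"
    by transfer (intro L2_rel_eqI square_integrable_scale; (simp add: L2_rel_def)?)
  show "1 *\<^sub>R f = f"
    by transfer simp
qed

end

instantiation L2 :: real_inner
begin

lift_definition inner_L2 :: "L2 \<Rightarrow> L2 \<Rightarrow> real" is "\<lambda>f g. LINT t|leb_pi. f t * g t"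
proof -
  fix f f' g g' assume *: "L2_rel f f'" "L2_rel g g'"
  then have m: "f \<in> borel_measurable leb_pi" "f' \<in> borel_measurable leb_pi"
      "g \<in> borel_measurable leb_pi" "g' \<in> borel_measurable leb_pi"
    unfolding L2_rel_def square_integrable_def by auto
  show "(LINT t|leb_pi. f t * g t) = (LINT t|leb_pi. f' t * g' t)"
    using m AE_eq_binop[where h = "(*)" and f = f and g = g] * unfolding L2_rel_def
    by (intro integral_cong_AE borel_measurable_times) auto
qed

definition norm_L2 :: "L2 \<Rightarrow> real" where
  "norm_L2 f = sqrt (inner f f)"

definition sgn_L2 :: "L2 \<Rightarrow> L2" where
  "sgn_L2 f = f /\<^sub>R norm f"

definition dist_L2 :: "L2 \<Rightarrow> L2 \<Rightarrow> real" where
  "dist_L2 f g = norm (f - g)"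

definition uniformity_L2 :: "(L2 \<times> L2) filter" where
  "uniformity_L2 = (INF e\<in>{0<..}. principal {(f, g). dist f g < e})"

definition open_L2 :: "L2 set \<Rightarrow> bool" where
  "open_L2 U \<longleftrightarrow> (\<forall>f\<in>U. \<forall>\<^sub>F (f', g) in uniformity. f' = f \<longrightarrow> g \<in> U)"

instance
proof
  fix f g h :: L2 and c :: real and U :: "L2 set"
  show "inner f g = inner g f" by transfer (simp add: mult.commute)
  show "inner (f + g) h = inner f h + inner g h"
    by transfer (simp add: L2_rel_def algebra_simps square_integrable_mult)
  show "inner (c *\<^sub>R f) g = c * inner f g"
    by transfer (simp add: L2_rel_def algebra_simps square_integrable_mult)
  show "0 \<le> inner f f" by transfer simp
  show "(inner f f = 0) = (f = 0)"
  proof transfer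
    fix f assume "L2_rel f f"
    then have f: "square_integrable f" unfolding L2_rel_def by simp
    have "(LINT t|leb_pi. f t * f t) = 0 \<longleftrightarrow> (AE t in leb_pi. f t * f t = 0)"
      by (intro integral_nonneg_eq_0_iff_AE square_integrable_mult f) auto
    moreover have "square_integrable (\<lambda>_. 0)"
      unfolding square_integrable_def by simp
    ultimately show "((LINT t|leb_pi. f t * f t) = 0) = L2_rel f (\<lambda>_. 0)"
      using f unfolding L2_rel_def by simp
  qed
qed (fact norm_L2_def sgn_L2_def dist_L2_def uniformity_L2_def open_L2_def)+

end

text \<open>Test functions are taken in \<open>C\<^sup>1\<close> rather than \<open>C\<^sup>\<infinity>\<close>; by mollification
  both classes define the same weak derivatives.\<close>

definition test_function :: "(real \<Rightarrow> real) \<Rightarrow> bool" where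
  "test_function \<phi> \<longleftrightarrow> \<phi> C1_differentiable_on UNIV \<and>
     (\<exists>a b. - pi < a \<and> b < pi \<and> (\<forall>t. t \<notin> {a..b} \<longrightarrow> \<phi> t = 0))"

definition has_weak_deriv :: "(real \<Rightarrow> real) \<Rightarrow> (real \<Rightarrow> real) \<Rightarrow> bool" where
  "has_weak_deriv v w \<longleftrightarrow> (\<forall>\<phi>. test_function \<phi> \<longrightarrow>
     (LINT t|leb_pi. v t * deriv \<phi> t) = - (LINT t|leb_pi. w t * \<phi> t))"

lemma test_function_deriv:
  assumes "test_function \<phi>"
  shows "(\<phi> has_real_derivative deriv \<phi> t) (at t)" "continuous_on UNIV (deriv \<phi>)"
proof -
  obtain D where D: "\<And>t. (\<phi> has_vector_derivative D t) (at t)" "continuous_on UNIV D"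
    using assms unfolding test_function_def C1_differentiable_on_def by auto
  then have *: "(\<phi> has_real_derivative D t) (at t)" for t
    by (simp add: has_real_derivative_iff_has_vector_derivative)
  then have "deriv \<phi> = D" by (auto intro!: DERIV_imp_deriv)
  with * D show "(\<phi> has_real_derivative deriv \<phi> t) (at t)" "continuous_on UNIV (deriv \<phi>)"
    by auto
qed

lemma test_function_square_integrable:
  assumes "test_function \<phi>"
  shows "square_integrable \<phi>" "square_integrable (deriv \<phi>)"
proof -
  have "continuous_on {-pi..pi} \<phi>"
    using test_function_deriv(1)[OF assms]
    by (intro continuous_at_imp_continuous_on ballI DERIV_isCont)
  then show "square_integrable \<phi>" by (rule square_integrable_continuous)
  show "square_integrable (deriv \<phi>)"
    by (intro square_integrable_continuous continuous_on_subset[OF test_function_deriv(2)[OF assms]]) auto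
qed

lemma borel_measurable_indicator_lebesgue:
  assumes "A \<in> sets borel"
  shows "indicat_real A \<in> borel_measurable lebesgue" "indicat_real A \<in> borel_measurable leb_pi"
proof -
  show *: "indicat_real A \<in> borel_measurable lebesgue"
    using assms by (intro measurable_completion borel_measurable_indicator) simp
  show "indicat_real A \<in> borel_measurable leb_pi"
    using * by (rule measurable_restrict_space1)
qed

lemma integral_Ioo_eq_0:
  assumes w: "integrable leb_pi w"
    and 0: "\<And>\<phi>. test_function \<phi> \<Longrightarrow> (LINT t|leb_pi. w t * \<phi> t) = 0"
    and ab: "-pi < a" "b < pi"
  shows "(LINT t|leb_pi. w t * indicator {a<..<b} t) = 0"
proof (cases "a < b")
  case True
  define M :: real where "M = ((b - a) / 2) ^ 4"
  have M: "M > 0" using True by (simp add: M_def)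
  define m :: "real \<Rightarrow> real" where "m x = (max 0 x)\<^sup>2" for x
  have m: "(m has_real_derivative 2 * max 0 x) (at x)" for x
  proof -
    consider "x < 0" | "x = 0" | "x > 0" by linarith
    then show ?thesis
    proof cases
      case 1
      have "((\<lambda>_. 0) has_real_derivative 0) (at x)" by simp
      then have "(m has_real_derivative 0) (at x)"
        by (rule has_field_derivative_transform_within_open[where S = "{..<0}"])
          (use 1 in \<open>auto simp: m_def\<close>)
      then show ?thesis using 1 by simp
    next
      case 3
      have "((\<lambda>y. y\<^sup>2) has_real_derivative 2 * x) (at x)"
        by (auto intro!: derivative_eq_intros)
      then have "(m has_real_derivative 2 * x) (at x)"
        by (rule has_field_derivative_transform_within_open[where S = "{0<..}"])
          (use 3 in \<open>auto simp: m_def\<close>)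
      then show ?thesis using 3 by simp
    next
      case 2
      have "((\<lambda>h. (m h - m 0) / h) \<longlongrightarrow> 0) (at 0)"
      proof (rule Lim_null_comparison)
        show "\<forall>\<^sub>F h in at 0. norm ((m h - m 0) / h) \<le> \<bar>h\<bar>"
          by (intro always_eventually) (auto simp: m_def max_def power2_eq_square)
        show "((\<lambda>h. \<bar>h\<bar>) \<longlongrightarrow> 0) (at (0::real))"
          by (intro tendsto_rabs_zero) simp
      qed
      then show ?thesis using 2 by (simp add: DERIV_def)
    qed
  qed
  define p where "p t = m ((t - a) * (b - t)) / M" for t
  define p' where "p' t = 2 * max 0 ((t - a) * (b - t)) * (a + b - 2 * t) / M" for t
  have p: "(p has_real_derivative p' t) (at t)" for t
  proof -
    have "((\<lambda>t. (t - a) * (b - t)) has_real_derivative (a + b - 2 * t)) (at t)"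
      by (auto intro!: derivative_eq_intros simp: algebra_simps)
    from DERIV_chain2[OF m this]
    show ?thesis unfolding p_def[abs_def] p'_def by (intro DERIV_cdivide)
  qed
  have p'_cont: "continuous_on UNIV p'"
    unfolding p'_def[abs_def] using M by (auto intro!: continuous_intros)
  have p_cont: "continuous_on UNIV p"
    using p by (intro continuous_at_imp_continuous_on ballI DERIV_isCont)
  have p0: "p t = 0" if "t \<notin> {a<..<b}" for t
    using that True mult_nonneg_nonneg[of "a - t" "b - t"] mult_nonneg_nonneg[of "t - a" "t - b"]
    by (auto simp: p_def m_def max_def not_less algebra_simps)
  have p_le: "0 \<le> p t" "p t \<le> 1" for t
  proof -
    show "0 \<le> p t" using M by (simp add: p_def m_def)
    have "(t - a) * (b - t) \<le> ((b - a) / 2)\<^sup>2"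
    proof -
      have "0 \<le> (t - (a + b) / 2)\<^sup>2" by simp
      then show ?thesis by (simp add: power2_eq_square field_simps)
    qed
    then have "max 0 ((t - a) * (b - t)) \<le> ((b - a) / 2)\<^sup>2" by simp
    then have "m ((t - a) * (b - t)) \<le> (((b - a) / 2)\<^sup>2)\<^sup>2"
      unfolding m_def by (intro power_mono) auto
    then show "p t \<le> 1" using M unfolding p_def M_def by (simp flip: power_mult)
  qed
  have p_pos: "0 < p t" if "t \<in> {a<..<b}" for t
    using that M by (simp add: p_def m_def)
  define q where "q k t = 1 - (1 - p t) ^ k" for k :: nat and t
  have q_test: "test_function (q k)" for k
  proof -
    have "(q k has_real_derivative of_nat k * (1 - p t) ^ (k - 1) * p' t) (at t)" for t
      unfolding q_def[abs_def] by (auto intro!: derivative_eq_intros p)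
    moreover have "continuous_on UNIV (\<lambda>t. of_nat k * (1 - p t) ^ (k - 1) * p' t)"
      by (intro continuous_intros p_cont p'_cont)
    ultimately have "q k C1_differentiable_on UNIV"
      unfolding C1_differentiable_on_def has_real_derivative_iff_has_vector_derivative
      by (intro exI[of _ "\<lambda>t. of_nat k * (1 - p t) ^ (k - 1) * p' t"]) simp
    then show ?thesis unfolding test_function_def
      using ab p0 by (intro conjI exI[of _ a] exI[of _ b]) (auto simp: q_def)
  qed
  have "(\<lambda>k. LINT t|leb_pi. w t * q k t) \<longlonglongrightarrow> (LINT t|leb_pi. w t * indicator {a<..<b} t)"
  proof (rule integral_dominated_convergence[where w = "\<lambda>t. \<bar>w t\<bar>"])
    have [measurable]: "w \<in> borel_measurable leb_pi" using w by auto
    show "(\<lambda>t. w t * indicator {a<..<b} t) \<in> borel_measurable leb_pi"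
      by (intro borel_measurable_times borel_measurable_indicator_lebesgue) auto
    show "(\<lambda>t. w t * q k t) \<in> borel_measurable leb_pi" for k
      using test_function_square_integrable(1)[OF q_test] unfolding square_integrable_def
      by (intro borel_measurable_times) auto
    show "integrable leb_pi (\<lambda>t. \<bar>w t\<bar>)" using w by simp
    have "(\<lambda>k. q k t) \<longlonglongrightarrow> indicator {a<..<b} t" for t
    proof (cases "t \<in> {a<..<b}")
      case True
      have "(\<lambda>k. (1 - p t) ^ k) \<longlonglongrightarrow> 0"
        using p_pos[OF True] p_le[of t] by (intro LIMSEQ_realpow_zero) auto
      from tendsto_diff[OF tendsto_const[of 1] this] show ?thesis
        using True by (simp add: q_def)
    qed (simp add: q_def p0)
    then show "AE t in leb_pi. (\<lambda>k. w t * q k t) \<longlonglongrightarrow> w t * indicator {a<..<b} t"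
      by (intro AE_I2 tendsto_mult tendsto_const)
    have "\<bar>q k t\<bar> \<le> 1" for k t
      using p_le[of t] power_le_one[of "1 - p t" k] zero_le_power[of "1 - p t" k]
      by (simp add: q_def)
    then show "AE t in leb_pi. norm (w t * q k t) \<le> \<bar>w t\<bar>" for k
      by (intro AE_I2) (simp add: abs_mult mult_left_le)
  qed
  then show ?thesis using 0[OF q_test] by (simp add: LIMSEQ_const_iff)
qed simp

lemma integral_Ioi_eq_0:
  assumes w: "integrable leb_pi w"
    and 0: "\<And>\<phi>. test_function \<phi> \<Longrightarrow> (LINT t|leb_pi. w t * \<phi> t) = 0"
  shows "(LINT t|leb_pi. w t * indicator {x<..} t) = 0"
proof -
  define a where "a k = max x (- pi) + 1 / real (Suc k)" for k
  define b where "b k = pi - 1 / real (Suc k)" for k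
  have "(\<lambda>k. LINT t|leb_pi. w t * indicator {a k<..<b k} t) \<longlonglongrightarrow> (LINT t|leb_pi. w t * indicator {x<..} t)"
  proof (rule integral_dominated_convergence[where w = "\<lambda>t. \<bar>w t\<bar>"])
    have [measurable]: "w \<in> borel_measurable leb_pi" using w by auto
    show "(\<lambda>t. w t * indicator {x<..} t) \<in> borel_measurable leb_pi"
      by (intro borel_measurable_times borel_measurable_indicator_lebesgue) auto
    show "(\<lambda>t. w t * indicator {a k<..<b k} t) \<in> borel_measurable leb_pi" for k
      by (intro borel_measurable_times borel_measurable_indicator_lebesgue) auto
    show "integrable leb_pi (\<lambda>t. \<bar>w t\<bar>)" using w by simp
    show "AE t in leb_pi. norm (w t * indicator {a k<..<b k} t) \<le> \<bar>w t\<bar>" for k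
      by (intro AE_I2) (simp add: indicator_def)
    have lim: "(\<lambda>k. 1 / real (Suc k)) \<longlonglongrightarrow> 0"
      using LIMSEQ_inverse_real_of_nat by (simp add: inverse_eq_divide)
    have a: "a \<longlonglongrightarrow> max x (- pi)" unfolding a_def[abs_def]
      using tendsto_add[OF tendsto_const lim] by simp
    have b: "b \<longlonglongrightarrow> pi" unfolding b_def[abs_def]
      using tendsto_diff[OF tendsto_const lim] by simp
    have "(\<lambda>k. w t * indicator {a k<..<b k} t) \<longlonglongrightarrow> w t * indicator {x<..} t"
      if t: "t \<in> {-pi<..<pi}" for t
    proof (rule tendsto_eventually)
      show "\<forall>\<^sub>F k in sequentially. w t * indicator {a k<..<b k} t = w t * indicator {x<..} t"
      proof (cases "x < t")
        case True
        then have "\<forall>\<^sub>F k in sequentially. a k < t" "\<forall>\<^sub>F k in sequentially. t < b k"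
          using order_tendstoD(2)[OF a, of t] order_tendstoD(1)[OF b, of t] t by auto
        then show ?thesis by eventually_elim (use True in simp)
      next
        case False
        moreover have "x < a k" for k unfolding a_def
          by (smt (verit, best) divide_pos_pos of_nat_0_less_iff zero_less_Suc)
        ultimately have "t \<notin> {a k<..<b k}" for k
          by (metis greaterThanLessThan_iff less_trans)
        then show ?thesis using False by (intro always_eventually) simp
      qed
    qed
    then show "AE t in leb_pi. (\<lambda>k. w t * indicator {a k<..<b k} t) \<longlonglongrightarrow> w t * indicator {x<..} t"
      by (intro AE_I2) simp
  qed
  moreover have "(LINT t|leb_pi. w t * indicator {a k<..<b k} t) = 0" for k
  proof (rule integral_Ioo_eq_0[OF w 0])
    have "1 / real (Suc k) > 0" by simp
    then show "- pi < a k" "b k < pi" unfolding a_def b_def by linarith+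
  qed
  ultimately show ?thesis by (simp add: LIMSEQ_const_iff)
qed

text \<open>The fundamental lemma of the calculus of variations.\<close>

lemma AE_eq_0_if_orthogonal_test_functions:
  assumes w: "integrable leb_pi w"
    and 0: "\<And>\<phi>. test_function \<phi> \<Longrightarrow> (LINT t|leb_pi. w t * \<phi> t) = 0"
  shows "AE t in leb_pi. w t = 0"
proof -
  let ?I = "{-pi<..<pi} :: real set"
  define u where "u t = indicator ?I t * w t" for t
  have u: "integrable lebesgue u"
    using w integrable_restrict_space[of ?I lebesgue w] unfolding u_def[abs_def] by simp
  obtain g where g: "g \<in> borel_measurable lborel" "AE t in lborel. u t = g t"
    using completion_ex_borel_measurable_real[of u lborel] u by auto
  have g_leb: "g \<in> borel_measurable lebesgue" using g(1) by (rule measurable_completion)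
  have ug: "AE t in lebesgue. u t = g t" using g(2) by (rule AE_completion)
  have g_int: "integrable lborel g"
    using integrable_cong_AE_imp[OF u g_leb] ug integrable_completion[OF g(1)] by auto
  have g0: "(LINT t|lborel. indicator {x<..} t * g t) = 0" for x
  proof -
    have "(LINT t|lborel. indicator {x<..} t * g t) = (LINT t|lebesgue. indicator {x<..} t * g t)"
      using g(1) by (intro integral_completion[symmetric]) auto
    also have "\<dots> = (LINT t|lebesgue. indicator {x<..} t * u t)"
      using ug u g_leb
      by (intro integral_cong_AE borel_measurable_times borel_measurable_indicator_lebesgue) auto
    also have "\<dots> = (LINT t|leb_pi. w t * indicator {x<..} t)"
      by (subst integral_restrict_space) (auto simp: u_def mult_ac)
    also have "\<dots> = 0" by (rule integral_Ioi_eq_0[OF w 0])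
    finally show ?thesis .
  qed
  have int: "integrable lborel (\<lambda>t. max 0 (s * g t) * indicator {x<..} t)" for x s
    using g_int by (intro integrable_real_mult_indicator integrable_max) auto
  have dens: "emeasure (density lborel (\<lambda>t. ennreal (max 0 (s * g t)))) {x<..}
      = ennreal (LINT t|lborel. max 0 (s * g t) * indicator {x<..} t)" for x s
  proof -
    have "emeasure (density lborel (\<lambda>t. ennreal (max 0 (s * g t)))) {x<..}
        = (\<integral>\<^sup>+t. ennreal (max 0 (s * g t)) * indicator {x<..} t \<partial>lborel)"
      using g(1) by (intro emeasure_density) auto
    also have "\<dots> = (\<integral>\<^sup>+t. ennreal (max 0 (s * g t) * indicator {x<..} t) \<partial>lborel)"
      by (intro nn_integral_cong) (auto simp: indicator_def)
    also have "\<dots> = ennreal (LINT t|lborel. max 0 (s * g t) * indicator {x<..} t)"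
      by (intro nn_integral_eq_integral int AE_I2) auto
    finally show ?thesis .
  qed
  have "density lborel (\<lambda>t. ennreal (max 0 (1 * g t))) = density lborel (\<lambda>t. ennreal (max 0 (-1 * g t)))"
  proof (rule measure_eqI_lessThan)
    fix x
    show "emeasure (density lborel (\<lambda>t. ennreal (max 0 (1 * g t)))) {x<..} < \<infinity>"
      unfolding dens by simp
    have "(LINT t|lborel. max 0 (1 * g t) * indicator {x<..} t)
        - (LINT t|lborel. max 0 (-1 * g t) * indicator {x<..} t)
        = (LINT t|lborel. max 0 (1 * g t) * indicator {x<..} t - max 0 (-1 * g t) * indicator {x<..} t)"
      by (intro Bochner_Integration.integral_diff[symmetric] int)
    also have "\<dots> = (LINT t|lborel. indicator {x<..} t * g t)"
      by (intro Bochner_Integration.integral_cong) (auto simp: max_def)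
    finally show "emeasure (density lborel (\<lambda>t. ennreal (max 0 (1 * g t)))) {x<..}
        = emeasure (density lborel (\<lambda>t. ennreal (max 0 (-1 * g t)))) {x<..}"
      unfolding dens g0 by simp
  qed simp_all
  then have "AE t in lborel. ennreal (max 0 (1 * g t)) = ennreal (max 0 (-1 * g t))"
    using g(1) by (intro sigma_finite_measure.density_unique[OF lborel.sigma_finite_measure_axioms]) auto
  then have "AE t in lborel. g t = 0"
    by eventually_elim (simp add: max_def split: if_splits)
  then have "AE t in lebesgue. g t = 0" by (rule AE_completion)
  with ug have "AE t in lebesgue. u t = 0" by eventually_elim simp
  then have "AE t in lebesgue. t \<in> ?I \<longrightarrow> w t = 0"
    by eventually_elim (auto simp: u_def indicator_def split: if_splits)
  then show ?thesis by (subst AE_restrict_space_iff) auto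
qed

lemma has_weak_deriv_unique:
  assumes "square_integrable w" "square_integrable w'"
    and "has_weak_deriv v w" "has_weak_deriv v w'"
  shows "AE t in leb_pi. w t = w' t"
proof -
  have "AE t in leb_pi. w t - w' t = 0"
  proof (rule AE_eq_0_if_orthogonal_test_functions)
    show "integrable leb_pi (\<lambda>t. w t - w' t)"
      using assms by (intro square_integrable_imp_integrable square_integrable_diff)
    fix \<phi> assume \<phi>: "test_function \<phi>"
    have "(LINT t|leb_pi. (w t - w' t) * \<phi> t)
        = (LINT t|leb_pi. w t * \<phi> t) - (LINT t|leb_pi. w' t * \<phi> t)"
      using assms test_function_square_integrable(1)[OF \<phi>]
      by (simp add: left_diff_distrib square_integrable_mult)
    also have "\<dots> = 0" using assms \<phi> unfolding has_weak_deriv_def by fastforce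
    finally show "(LINT t|leb_pi. (w t - w' t) * \<phi> t) = 0" .
  qed
  then show ?thesis by simp
qed

lemma has_weak_deriv_add:
  assumes "square_integrable v" "square_integrable w" "has_weak_deriv v w"
    and "square_integrable v'" "square_integrable w'" "has_weak_deriv v' w'"
  shows "has_weak_deriv (\<lambda>t. v t + v' t) (\<lambda>t. w t + w' t)"
  using assms test_function_square_integrable unfolding has_weak_deriv_def
  by (simp add: distrib_right square_integrable_mult)

lemma has_weak_deriv_scale:
  assumes "has_weak_deriv v w"
  shows "has_weak_deriv (\<lambda>t. c * v t) (\<lambda>t. c * w t)"
  using assms unfolding has_weak_deriv_def by (simp add: mult.assoc)

lemma has_weak_deriv_cong_AE:
  assumes "square_integrable w" "square_integrable w'" "AE t in leb_pi. w t = w' t"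
    and "has_weak_deriv v w"
  shows "has_weak_deriv v w'"
proof -
  have "(LINT t|leb_pi. w t * \<phi> t) = (LINT t|leb_pi. w' t * \<phi> t)" if "test_function \<phi>" for \<phi>
    using assms test_function_square_integrable(1)[OF that] unfolding square_integrable_def
    by (intro integral_cong_AE borel_measurable_times) auto
  with assms(4) show ?thesis unfolding has_weak_deriv_def by simp
qed

lemma has_weak_deriv_classical:
  assumes v: "continuous_on {-pi..pi} v" and w: "continuous_on {-pi..pi} w"
    and deriv: "\<And>t. t \<in> {-pi<..<pi} \<Longrightarrow> (v has_real_derivative w t) (at t)"
  shows "has_weak_deriv v w"
  unfolding has_weak_deriv_def
proof (intro allI impI)
  fix \<phi> assume \<phi>: "test_function \<phi>"
  have \<phi>0: "\<phi> (-pi) = 0" "\<phi> pi = 0"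
    using \<phi> unfolding test_function_def by force+
  have \<phi>c: "continuous_on {-pi..pi} \<phi>"
    using test_function_deriv(1)[OF \<phi>]
    by (intro continuous_at_imp_continuous_on ballI DERIV_isCont)
  have si: "integrable leb_pi (\<lambda>t. v t * deriv \<phi> t)" "integrable leb_pi (\<lambda>t. w t * \<phi> t)"
    by (intro square_integrable_mult square_integrable_continuous v w
        test_function_square_integrable[OF \<phi>])+
  have "((\<lambda>t. v t * deriv \<phi> t + w t * \<phi> t) has_integral (v pi * \<phi> pi - v (-pi) * \<phi> (-pi))) {-pi..pi}"
  proof (rule fundamental_theorem_of_calculus_interior)
    show "continuous_on {-pi..pi} (\<lambda>t. v t * \<phi> t)"
      by (intro continuous_intros v \<phi>c)
    fix t assume "t \<in> {-pi<..<pi}"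
    from DERIV_mult[OF deriv[OF this] test_function_deriv(1)[OF \<phi>]]
    show "((\<lambda>t. v t * \<phi> t) has_vector_derivative v t * deriv \<phi> t + w t * \<phi> t) (at t)"
      by (simp add: has_real_derivative_iff_has_vector_derivative algebra_simps)
  qed simp
  then have "((\<lambda>t. v t * deriv \<phi> t + w t * \<phi> t) has_integral 0) {-pi<..<pi}"
    by (simp add: \<phi>0 has_integral_Icc_iff_Ioo)
  moreover have "((\<lambda>t. v t * deriv \<phi> t + w t * \<phi> t) has_integral
      (LINT t|leb_pi. v t * deriv \<phi> t + w t * \<phi> t)) {-pi<..<pi}"
    by (intro has_integral_integral_lebesgue_on Bochner_Integration.integrable_add si) simp
  ultimately have "(LINT t|leb_pi. v t * deriv \<phi> t + w t * \<phi> t) = 0"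
    using has_integral_unique by blast
  then show "(LINT t|leb_pi. v t * deriv \<phi> t) = - (LINT t|leb_pi. w t * \<phi> t)"
    using si by simp
qed

definition abs_continuous_on :: "real set \<Rightarrow> (real \<Rightarrow> real) \<Rightarrow> bool" where
  "abs_continuous_on S f \<longleftrightarrow> (\<forall>\<epsilon>>0. \<exists>\<delta>>0. \<forall>(n::nat) a b.
     (\<forall>i<n. a i \<le> b i \<and> {a i..b i} \<subseteq> S) \<and>
     disjoint_family_on (\<lambda>i. {a i<..<b i}) {..<n} \<and>
     (\<Sum>i<n. b i - a i) < \<delta> \<longrightarrow> (\<Sum>i<n. \<bar>f (b i) - f (a i)\<bar>) < \<epsilon>)"

lemma abs_continuous_onE:
  assumes "abs_continuous_on S f" "\<epsilon> > 0"
  obtains \<delta> where "\<delta> > 0" "\<forall>(n::nat) a b. (\<forall>i<n. a i \<le> b i \<and> {a i..b i} \<subseteq> S) \<and>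
     disjoint_family_on (\<lambda>i. {a i<..<b i}) {..<n} \<and>
     (\<Sum>i<n. b i - a i) < \<delta> \<longrightarrow> (\<Sum>i<n. \<bar>f (b i) - f (a i)\<bar>) < \<epsilon>"
  using assms(1)[unfolded abs_continuous_on_def, THEN spec, THEN mp, OF assms(2)] that by blast

lemma abs_continuous_on_add:
  assumes "abs_continuous_on S f" "abs_continuous_on S g"
  shows "abs_continuous_on S (\<lambda>t. f t + g t)"
  unfolding abs_continuous_on_def
proof (intro allI impI)
  fix \<epsilon> :: real assume "\<epsilon> > 0"
  then have "\<epsilon> / 2 > 0" by simp
  obtain \<delta>1 where 1: "\<delta>1 > 0" "\<forall>(n::nat) a b. (\<forall>i<n. a i \<le> b i \<and> {a i..b i} \<subseteq> S) \<and>
     disjoint_family_on (\<lambda>i. {a i<..<b i}) {..<n} \<and>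
     (\<Sum>i<n. b i - a i) < \<delta>1 \<longrightarrow> (\<Sum>i<n. \<bar>f (b i) - f (a i)\<bar>) < \<epsilon> / 2"
    by (rule abs_continuous_onE[OF assms(1) \<open>\<epsilon> / 2 > 0\<close>])
  obtain \<delta>2 where 2: "\<delta>2 > 0" "\<forall>(n::nat) a b. (\<forall>i<n. a i \<le> b i \<and> {a i..b i} \<subseteq> S) \<and>
     disjoint_family_on (\<lambda>i. {a i<..<b i}) {..<n} \<and>
     (\<Sum>i<n. b i - a i) < \<delta>2 \<longrightarrow> (\<Sum>i<n. \<bar>g (b i) - g (a i)\<bar>) < \<epsilon> / 2"
    by (rule abs_continuous_onE[OF assms(2) \<open>\<epsilon> / 2 > 0\<close>])
  show "\<exists>\<delta>>0. \<forall>(n::nat) a b. (\<forall>i<n. a i \<le> b i \<and> {a i..b i} \<subseteq> S) \<and>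
     disjoint_family_on (\<lambda>i. {a i<..<b i}) {..<n} \<and>
     (\<Sum>i<n. b i - a i) < \<delta> \<longrightarrow> (\<Sum>i<n. \<bar>f (b i) + g (b i) - (f (a i) + g (a i))\<bar>) < \<epsilon>"
  proof (intro exI[of _ "min \<delta>1 \<delta>2"] conjI allI impI)
    fix n :: nat and a b :: "nat \<Rightarrow> real"
    assume *: "(\<forall>i<n. a i \<le> b i \<and> {a i..b i} \<subseteq> S) \<and>
     disjoint_family_on (\<lambda>i. {a i<..<b i}) {..<n} \<and> (\<Sum>i<n. b i - a i) < min \<delta>1 \<delta>2"
    have "(\<Sum>i<n. \<bar>f (b i) + g (b i) - (f (a i) + g (a i))\<bar>)
        \<le> (\<Sum>i<n. \<bar>f (b i) - f (a i)\<bar> + \<bar>g (b i) - g (a i)\<bar>)"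
      by (intro sum_mono) linarith
    also have "\<dots> = (\<Sum>i<n. \<bar>f (b i) - f (a i)\<bar>) + (\<Sum>i<n. \<bar>g (b i) - g (a i)\<bar>)"
      by (rule sum.distrib)
    also have "\<dots> < \<epsilon> / 2 + \<epsilon> / 2"
      using * by (intro add_strict_mono 1(2)[rule_format] 2(2)[rule_format]) auto
    finally show "(\<Sum>i<n. \<bar>f (b i) + g (b i) - (f (a i) + g (a i))\<bar>) < \<epsilon>" by simp
  qed (use 1 2 in simp)
qed

lemma abs_continuous_on_lipschitz:
  assumes "\<And>s t. s \<in> S \<Longrightarrow> t \<in> S \<Longrightarrow> \<bar>f s - f t\<bar> \<le> C * \<bar>s - t\<bar>"
  shows "abs_continuous_on S f"
  unfolding abs_continuous_on_def
proof (intro allI impI)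
  fix \<epsilon> :: real assume "\<epsilon> > 0"
  define K where "K = max C 1"
  have "K > 0" by (simp add: K_def)
  show "\<exists>\<delta>>0. \<forall>(n::nat) a b. (\<forall>i<n. a i \<le> b i \<and> {a i..b i} \<subseteq> S) \<and>
     disjoint_family_on (\<lambda>i. {a i<..<b i}) {..<n} \<and>
     (\<Sum>i<n. b i - a i) < \<delta> \<longrightarrow> (\<Sum>i<n. \<bar>f (b i) - f (a i)\<bar>) < \<epsilon>"
  proof (intro exI[of _ "\<epsilon> / K"] conjI allI impI)
    fix n :: nat and a b :: "nat \<Rightarrow> real"
    assume *: "(\<forall>i<n. a i \<le> b i \<and> {a i..b i} \<subseteq> S) \<and>
     disjoint_family_on (\<lambda>i. {a i<..<b i}) {..<n} \<and> (\<Sum>i<n. b i - a i) < \<epsilon> / K"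
    have "\<bar>f (b i) - f (a i)\<bar> \<le> K * (b i - a i)" if "i < n" for i
    proof -
      have i: "a i \<le> b i" "{a i..b i} \<subseteq> S" using * that by auto
      then have "a i \<in> S" "b i \<in> S" by (auto simp: subset_eq)
      then have "\<bar>f (b i) - f (a i)\<bar> \<le> C * (b i - a i)" using assms[of "b i" "a i"] i by simp
      also have "\<dots> \<le> K * (b i - a i)" using i by (intro mult_right_mono) (auto simp: K_def)
      finally show ?thesis .
    qed
    then have "(\<Sum>i<n. \<bar>f (b i) - f (a i)\<bar>) \<le> (\<Sum>i<n. K * (b i - a i))"
      by (intro sum_mono) simp
    also have "\<dots> = K * (\<Sum>i<n. b i - a i)" by (simp add: sum_distrib_left)
    also have "\<dots> < \<epsilon>" using * \<open>K > 0\<close> by (simp add: pos_less_divide_eq mult.commute)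
    finally show "(\<Sum>i<n. \<bar>f (b i) - f (a i)\<bar>) < \<epsilon>" .
  qed (use \<open>\<epsilon> > 0\<close> \<open>K > 0\<close> in simp)
qed

lemma abs_continuous_on_scale:
  assumes "abs_continuous_on S f"
  shows "abs_continuous_on S (\<lambda>t. c * f t)"
  unfolding abs_continuous_on_def
proof (intro allI impI)
  fix \<epsilon> :: real assume "\<epsilon> > 0"
  define K where "K = \<bar>c\<bar> + 1"
  have "K > 0" by (simp add: K_def)
  then have "\<epsilon> / K > 0" using \<open>\<epsilon> > 0\<close> by simp
  obtain \<delta> where \<delta>: "\<delta> > 0" "\<forall>(n::nat) a b. (\<forall>i<n. a i \<le> b i \<and> {a i..b i} \<subseteq> S) \<and>
     disjoint_family_on (\<lambda>i. {a i<..<b i}) {..<n} \<and>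
     (\<Sum>i<n. b i - a i) < \<delta> \<longrightarrow> (\<Sum>i<n. \<bar>f (b i) - f (a i)\<bar>) < \<epsilon> / K"
    by (rule abs_continuous_onE[OF assms(1) \<open>\<epsilon> / K > 0\<close>])
  show "\<exists>\<delta>>0. \<forall>(n::nat) a b. (\<forall>i<n. a i \<le> b i \<and> {a i..b i} \<subseteq> S) \<and>
     disjoint_family_on (\<lambda>i. {a i<..<b i}) {..<n} \<and>
     (\<Sum>i<n. b i - a i) < \<delta> \<longrightarrow> (\<Sum>i<n. \<bar>c * f (b i) - c * f (a i)\<bar>) < \<epsilon>"
  proof (intro exI[of _ \<delta>] conjI allI impI)
    fix n :: nat and a b :: "nat \<Rightarrow> real"
    assume *: "(\<forall>i<n. a i \<le> b i \<and> {a i..b i} \<subseteq> S) \<and>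
     disjoint_family_on (\<lambda>i. {a i<..<b i}) {..<n} \<and> (\<Sum>i<n. b i - a i) < \<delta>"
    have "(\<Sum>i<n. \<bar>c * f (b i) - c * f (a i)\<bar>) = \<bar>c\<bar> * (\<Sum>i<n. \<bar>f (b i) - f (a i)\<bar>)"
      by (simp add: sum_distrib_left abs_mult flip: right_diff_distrib)
    also have "\<dots> \<le> K * (\<Sum>i<n. \<bar>f (b i) - f (a i)\<bar>)"
      by (intro mult_right_mono sum_nonneg) (auto simp: K_def)
    also have "\<dots> < \<epsilon>"
      using \<delta>(2)[rule_format, of n a b] * \<open>K > 0\<close> by (simp add: pos_less_divide_eq mult.commute)
    finally show "(\<Sum>i<n. \<bar>c * f (b i) - c * f (a i)\<bar>) < \<epsilon>" .
  qed (use \<delta> in simp)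
qed

lemma abs_continuous_on_imp_continuous_on:
  assumes "abs_continuous_on {l..u} f"
  shows "continuous_on {l..u} f"
  unfolding continuous_on_iff
proof (intro ballI allI impI)
  fix x :: real and \<epsilon> :: real assume x: "x \<in> {l..u}" and "\<epsilon> > 0"
  obtain \<delta> where \<delta>: "\<delta> > 0" "\<forall>(n::nat) a b. (\<forall>i<n. a i \<le> b i \<and> {a i..b i} \<subseteq> {l..u}) \<and>
     disjoint_family_on (\<lambda>i. {a i<..<b i}) {..<n} \<and>
     (\<Sum>i<n. b i - a i) < \<delta> \<longrightarrow> (\<Sum>i<n. \<bar>f (b i) - f (a i)\<bar>) < \<epsilon>"
    by (rule abs_continuous_onE[OF assms \<open>\<epsilon> > 0\<close>])
  show "\<exists>d>0. \<forall>x'\<in>{l..u}. dist x' x < d \<longrightarrow> dist (f x') (f x) < \<epsilon>"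
  proof (intro exI[of _ \<delta>] conjI ballI impI)
    fix y assume y: "y \<in> {l..u}" "dist y x < \<delta>"
    have "(\<Sum>i<1::nat. \<bar>f (max x y) - f (min x y)\<bar>) < \<epsilon>"
      by (rule \<delta>(2)[rule_format, of 1 "\<lambda>_. min x y" "\<lambda>_. max x y"])
        (use x y in \<open>auto simp: dist_real_def disjoint_family_on_def\<close>)
    then show "dist (f y) (f x) < \<epsilon>"
      by (auto simp: dist_real_def max_def min_def split: if_splits)
  qed (use \<delta> in simp)
qed

text \<open>Functions on \<open>[-\<pi>, \<pi>]\<close> are represented by total functions vanishing outside \<open>[-\<pi>, \<pi>]\<close>.\<close>

definition H0 :: "(real \<Rightarrow> real) set" where
  "H0 = {v. (\<forall>t. t \<notin> {-pi..pi} \<longrightarrow> v t = 0) \<and>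
     abs_continuous_on {-pi..pi} v \<and> v (-pi) = v pi \<and>
     (\<exists>w. square_integrable w \<and> has_weak_deriv v w)}"

lemma H0_continuous: "v \<in> H0 \<Longrightarrow> continuous_on {-pi..pi} v"
  unfolding H0_def by (auto intro: abs_continuous_on_imp_continuous_on)

lemma H0_square_integrable: "v \<in> H0 \<Longrightarrow> square_integrable v"
  by (intro square_integrable_continuous H0_continuous)

lemma H0_zero: "(\<lambda>_. 0) \<in> H0"
  unfolding H0_def has_weak_deriv_def
  by (auto intro!: abs_continuous_on_lipschitz[where C = 0] exI[of _ "\<lambda>_. 0"] square_integrable_zero)

lemma H0_add:
  assumes "u \<in> H0" "v \<in> H0"
  shows "(\<lambda>t. u t + v t) \<in> H0"
proof -
  obtain u' v' where *: "square_integrable u'" "has_weak_deriv u u'"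
      "square_integrable v'" "has_weak_deriv v v'"
    using assms unfolding H0_def by auto
  have "has_weak_deriv (\<lambda>t. u t + v t) (\<lambda>t. u' t + v' t)"
    by (intro has_weak_deriv_add H0_square_integrable assms *)
  moreover have "square_integrable (\<lambda>t. u' t + v' t)"
    by (intro square_integrable_add *)
  ultimately have "\<exists>w. square_integrable w \<and> has_weak_deriv (\<lambda>t. u t + v t) w" by blast
  with assms show ?thesis unfolding H0_def by (auto intro: abs_continuous_on_add)
qed

lemma H0_scale:
  assumes "v \<in> H0"
  shows "(\<lambda>t. c * v t) \<in> H0"
proof -
  have "\<exists>w. square_integrable w \<and> has_weak_deriv (\<lambda>t. c * v t) w"
    using assms square_integrable_scale has_weak_deriv_scale unfolding H0_def by blast
  with assms show ?thesis unfolding H0_def by (auto intro: abs_continuous_on_scale)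
qed

typedef even_H0 = "{v \<in> H0. \<forall>t. v (- t) = v t}"
  morphisms fun_of Abs_even_H0
  using H0_zero by auto

setup_lifting type_definition_even_H0

instantiation even_H0 :: real_vector
begin

lift_definition zero_even_H0 :: even_H0 is "\<lambda>_. 0"
  using H0_zero by simp

lift_definition plus_even_H0 :: "even_H0 \<Rightarrow> even_H0 \<Rightarrow> even_H0" is "\<lambda>u v t. u t + v t"
  using H0_add by simp

lift_definition uminus_even_H0 :: "even_H0 \<Rightarrow> even_H0" is "\<lambda>v t. - v t"
  using H0_scale[of _ "-1"] by simp

lift_definition minus_even_H0 :: "even_H0 \<Rightarrow> even_H0 \<Rightarrow> even_H0" is "\<lambda>u v t. u t - v t"
  using H0_add[OF _ H0_scale[of _ "-1"]] by simp

lift_definition scaleR_even_H0 :: "real \<Rightarrow> even_H0 \<Rightarrow> even_H0" is "\<lambda>c v t. c * v t"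
  using H0_scale by simp

instance
  by standard (transfer; simp add: fun_eq_iff algebra_simps)+

end

lift_definition L2_of :: "even_H0 \<Rightarrow> L2" is "\<lambda>v. v"
  by (simp add: L2_rel_def H0_square_integrable)

definition weak_deriv :: "even_H0 \<Rightarrow> L2" where
  "weak_deriv v = (THE w. has_weak_deriv (fun_of v) (rep_L2 w))"

lemma rep_L2_square_integrable: "square_integrable (rep_L2 w)"
  using Quotient_rep_reflp[OF Quotient_L2, of w] by (simp add: L2_rel_def)

lemma rep_abs_L2:
  assumes "square_integrable w"
  shows "AE t in leb_pi. rep_L2 (abs_L2 w) t = w t"
  using Quotient_rep_abs[OF Quotient_L2, of w] assms by (simp add: L2_rel_def)

lemma abs_L2_eqI:
  assumes "square_integrable v" "square_integrable w" "AE t in leb_pi. v t = w t"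
  shows "abs_L2 v = abs_L2 w"
  using assms by (intro Quotient_rel_abs[OF Quotient_L2]) (simp add: L2_rel_def)

lemma weak_deriv_eqI:
  assumes "square_integrable w" "has_weak_deriv (fun_of v) w"
  shows "weak_deriv v = abs_L2 w"
  unfolding weak_deriv_def
proof (rule the_equality)
  show "has_weak_deriv (fun_of v) (rep_L2 (abs_L2 w))"
    using has_weak_deriv_cong_AE[OF assms(1) rep_L2_square_integrable _ assms(2)] rep_abs_L2[OF assms(1)]
    by (simp add: eq_commute)
  fix w' assume "has_weak_deriv (fun_of v) (rep_L2 w')"
  then have "abs_L2 (rep_L2 w') = abs_L2 w"
    by (intro abs_L2_eqI has_weak_deriv_unique[OF _ assms(1) _ assms(2)] rep_L2_square_integrable assms(1))
  then show "w' = abs_L2 w" by (simp add: Quotient_abs_rep[OF Quotient_L2])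
qed

lemma weak_deriv_obtain:
  obtains w where "square_integrable w" "has_weak_deriv (fun_of v) w" "weak_deriv v = abs_L2 w"
proof -
  have "fun_of v \<in> H0" using fun_of[of v] by simp
  then obtain w where w: "square_integrable w" "has_weak_deriv (fun_of v) w"
    unfolding H0_def by auto
  show thesis by (rule that[OF w weak_deriv_eqI[OF w]])
qed

lemma weak_deriv_add: "weak_deriv (u + v) = weak_deriv u + weak_deriv v"
proof -
  obtain u' where u: "square_integrable u'" "has_weak_deriv (fun_of u) u'" "weak_deriv u = abs_L2 u'"
    by (rule weak_deriv_obtain)
  obtain v' where v: "square_integrable v'" "has_weak_deriv (fun_of v) v'" "weak_deriv v = abs_L2 v'"
    by (rule weak_deriv_obtain)
  have "weak_deriv (u + v) = abs_L2 (\<lambda>t. u' t + v' t)"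
    using u v has_weak_deriv_add[OF _ u(1,2) _ v(1,2)] fun_of[of u] fun_of[of v]
    by (intro weak_deriv_eqI square_integrable_add) (auto simp: plus_even_H0.rep_eq H0_square_integrable)
  also have "\<dots> = weak_deriv u + weak_deriv v"
    using u v by (simp add: plus_L2.abs_eq L2_rel_def)
  finally show ?thesis .
qed

lemma weak_deriv_scaleR: "weak_deriv (c *\<^sub>R v) = c *\<^sub>R weak_deriv v"
proof -
  obtain v' where v: "square_integrable v'" "has_weak_deriv (fun_of v) v'" "weak_deriv v = abs_L2 v'"
    by (rule weak_deriv_obtain)
  have "weak_deriv (c *\<^sub>R v) = abs_L2 (\<lambda>t. c * v' t)"
    using v by (intro weak_deriv_eqI square_integrable_scale)
      (auto simp: scaleR_even_H0.rep_eq has_weak_deriv_scale)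
  also have "\<dots> = c *\<^sub>R weak_deriv v"
    using v by (simp add: scaleR_L2.abs_eq L2_rel_def)
  finally show ?thesis .
qed

lemma L2_of_add: "L2_of (u + v) = L2_of u + L2_of v"
  by transfer (simp add: L2_rel_def H0_square_integrable square_integrable_add)

lemma L2_of_scaleR: "L2_of (c *\<^sub>R v) = c *\<^sub>R L2_of v"
  by transfer (simp add: L2_rel_def H0_square_integrable square_integrable_scale)

lemma L2_of_eq_0_iff: "L2_of v = 0 \<longleftrightarrow> v = 0"
proof
  assume "L2_of v = 0"
  then show "v = 0"
  proof transfer
    fix v assume v: "v \<in> H0 \<and> (\<forall>t. v (- t) = v t)" and "L2_rel v (\<lambda>_. 0)"
    then have "AE t in leb_pi. v t = 0" unfolding L2_rel_def by simp
    then have ae: "AE t in lebesgue. t \<in> {-pi<..<pi} \<longrightarrow> v t = 0"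
      by (simp add: AE_restrict_space_iff)
    define Z where "Z = {t \<in> {-pi..pi}. v t = 0}"
    have "closed Z"
      unfolding Z_def using v by (intro continuous_closed_preimage_constant H0_continuous) auto
    moreover have "{-pi<..<pi} \<subseteq> Z"
    proof
      fix t :: real assume t: "t \<in> {-pi<..<pi}"
      have "AE t\<in>{-pi<..<pi} in lebesgue. t \<in> Z"
        using ae by eventually_elim (auto simp: Z_def)
      then show "t \<in> Z"
        by (rule mem_closed_if_AE_lebesgue_open[OF open_greaterThanLessThan \<open>closed Z\<close> _ t])
    qed
    ultimately have "closure {-pi<..<pi} \<subseteq> Z" by (intro closure_minimal)
    then have "{-pi..pi} \<subseteq> Z" by (simp add: closure_greaterThanLessThan)
    then show "v = (\<lambda>_. 0)" using v unfolding Z_def H0_def by fastforce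
  qed
next
  assume "v = 0"
  then show "L2_of v = 0" using L2_of_scaleR[of 0 v] by simp
qed

text \<open>The norm induced by this inner product is the \<open>W\<^sup>1\<^sup>,\<^sup>2\<close> norm.\<close>

instantiation even_H0 :: real_inner
begin

definition inner_even_H0 :: "even_H0 \<Rightarrow> even_H0 \<Rightarrow> real" where
  "inner_even_H0 u v = inner (L2_of u) (L2_of v) + inner (weak_deriv u) (weak_deriv v)"

definition norm_even_H0 :: "even_H0 \<Rightarrow> real" where
  "norm_even_H0 v = sqrt (inner v v)"

definition sgn_even_H0 :: "even_H0 \<Rightarrow> even_H0" where
  "sgn_even_H0 v = v /\<^sub>R norm v"

definition dist_even_H0 :: "even_H0 \<Rightarrow> even_H0 \<Rightarrow> real" where
  "dist_even_H0 u v = norm (u - v)"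

definition uniformity_even_H0 :: "(even_H0 \<times> even_H0) filter" where
  "uniformity_even_H0 = (INF e\<in>{0<..}. principal {(u, v). dist u v < e})"

definition open_even_H0 :: "even_H0 set \<Rightarrow> bool" where
  "open_even_H0 U \<longleftrightarrow> (\<forall>u\<in>U. \<forall>\<^sub>F (u', v) in uniformity. u' = u \<longrightarrow> v \<in> U)"

instance
proof
  fix u v w :: even_H0 and c :: real
  show "inner u v = inner v u"
    by (simp add: inner_even_H0_def inner_commute)
  show "inner (u + v) w = inner u w + inner v w"
    by (simp add: inner_even_H0_def L2_of_add weak_deriv_add inner_add_left)
  show "inner (c *\<^sub>R u) v = c * inner u v"
    by (simp add: inner_even_H0_def L2_of_scaleR weak_deriv_scaleR distrib_left)
  show "0 \<le> inner u u"
    by (simp add: inner_even_H0_def)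
  have "weak_deriv 0 = 0" using weak_deriv_scaleR[of 0 u] by simp
  then show "(inner u u = 0) = (u = 0)"
    by (auto simp: inner_even_H0_def add_nonneg_eq_0_iff L2_of_eq_0_iff)
qed (fact norm_even_H0_def sgn_even_H0_def dist_even_H0_def uniformity_even_H0_def open_even_H0_def)+

end

text \<open>The product \<open>v w\<close> is again square integrable because \<open>v\<close> is continuous, hence bounded,
  on \<open>[-\<pi>, \<pi>]\<close>.\<close>

lift_definition mult_L2 :: "even_H0 \<Rightarrow> L2 \<Rightarrow> L2" is "\<lambda>v w t. v t * w t"
proof -
  fix v w w' assume v: "v \<in> H0 \<and> (\<forall>t. v (- t) = v t)" and w: "L2_rel w w'"
  have cont: "continuous_on {-pi..pi} v" using v H0_continuous by simp
  then have "compact (v ` {-pi..pi})" by (intro compact_continuous_image) simp_all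
  then obtain C where C: "\<And>t. t \<in> {-pi..pi} \<Longrightarrow> \<bar>v t\<bar> \<le> C"
    using compact_imp_bounded bounded_iff by (metis imageI real_norm_def)
  have "v \<in> borel_measurable leb_pi"
    using H0_square_integrable v unfolding square_integrable_def by simp
  then have "square_integrable (\<lambda>t. v t * g t)" if "square_integrable g" for g
    using that C by (intro square_integrable_bounded_mult[of v C]) auto
  then show "L2_rel (\<lambda>t. v t * w t) (\<lambda>t. v t * w' t)"
    using w AE_eq_binop[where h = "(*)" and f = v and f' = v] unfolding L2_rel_def by auto
qed

lift_definition one_L2 :: L2 is "\<lambda>_. 1"
  by (simp add: L2_rel_def square_integrable_continuous)

lift_definition cos_L2 :: "nat \<Rightarrow> L2" is "\<lambda>n t. cos (real n * t)"
  by (simp add: L2_rel_def square_integrable_continuous continuous_intros)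

lift_definition sin_L2 :: "nat \<Rightarrow> L2" is "\<lambda>n t. sin (real n * t)"
  by (simp add: L2_rel_def square_integrable_continuous continuous_intros)

lift_definition cos_even_H0 :: "nat \<Rightarrow> even_H0" is "\<lambda>n t. if t \<in> {-pi..pi} then cos (real n * t) else 0"
proof -
  fix n :: nat
  let ?v = "\<lambda>t. if t \<in> {-pi..pi} then cos (real n * t) else 0"
  let ?w = "\<lambda>t. - real n * sin (real n * t)"
  have "abs_continuous_on {-pi..pi} ?v"
  proof (rule abs_continuous_on_lipschitz[where C = "real n"])
    fix s t :: real assume "s \<in> {-pi..pi}" "t \<in> {-pi..pi}"
    moreover have "norm (cos (real n * s) - cos (real n * t)) \<le> real n * norm (s - t)"
    proof (rule field_differentiable_bound[where S = UNIV])
      show "((\<lambda>t. cos (real n * t)) has_field_derivative ?w t) (at t within UNIV)" for t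
        by (auto intro!: derivative_eq_intros)
      show "norm (?w t) \<le> real n" for t
        by (simp add: abs_mult mult_left_le)
    qed auto
    ultimately show "\<bar>?v s - ?v t\<bar> \<le> real n * \<bar>s - t\<bar>" by simp
  qed
  moreover have "square_integrable ?w"
    by (intro square_integrable_continuous continuous_intros)
  moreover have "has_weak_deriv ?v ?w"
  proof (rule has_weak_deriv_classical)
    have "continuous_on {-pi..pi} (\<lambda>t. cos (real n * t))" by (intro continuous_intros)
    then show "continuous_on {-pi..pi} ?v" by (rule continuous_on_eq) simp
    show "continuous_on {-pi..pi} ?w" by (intro continuous_intros)
    fix t assume t: "t \<in> {-pi<..<pi}"
    have "((\<lambda>t. cos (real n * t)) has_real_derivative ?w t) (at t)"
      by (auto intro!: derivative_eq_intros)
    then show "(?v has_real_derivative ?w t) (at t)"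
      by (rule has_field_derivative_transform_within_open[where S = "{-pi<..<pi}"]) (use t in auto)
  qed
  ultimately show "?v \<in> H0 \<and> (\<forall>t. ?v (- t) = ?v t)"
    unfolding H0_def by auto
qed

text \<open>For \<open>0 < r < 1\<close> exactly one operator satisfies this: the multipliers are bounded in \<open>n\<close>, and
  the trigonometric functions span a dense subspace of \<open>L\<^sup>2(-\<pi>, \<pi>)\<close>.\<close>

definition is_babenko_op :: "real \<Rightarrow> (L2 \<Rightarrow> L2) \<Rightarrow> bool" where
  "is_babenko_op r B \<longleftrightarrow> bounded_linear B \<and> B one_L2 = 0 \<and>
     (\<forall>n\<ge>1. B (cos_L2 n) = ((1 + r ^ (2 * n)) / (1 - r ^ (2 * n))) *\<^sub>R sin_L2 n \<and>
            B (sin_L2 n) = - ((1 + r ^ (2 * n)) / (1 - r ^ (2 * n))) *\<^sub>R cos_L2 n)"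

text \<open>The argument \<open>B\<close> stands for the operator characterised by \<open>is_babenko_op r\<close>.\<close>

definition babenko_F :: "(L2 \<Rightarrow> L2) \<Rightarrow> real \<times> even_H0 \<Rightarrow> L2" where
  "babenko_F B = (\<lambda>(\<mu>, v). \<mu> *\<^sub>R B (weak_deriv v) - L2_of v
     - mult_L2 v (B (weak_deriv v)) - B (mult_L2 v (weak_deriv v)))"

definition bif_point :: "real \<Rightarrow> nat \<Rightarrow> real" where
  "bif_point r n = (1 - r ^ (2 * n)) / (real n * (1 + r ^ (2 * n)))"

end

theory Submission
  imports Defs
begin

text \<open>This is bifurcation from a simple eigenvalue. On cosines the operator \<open>L v = B v'\<close> acts as the
  multiplier \<open>\<omega>\<^sub>k = k (1 + r\<^sup>2\<^sup>k) / (1 - r\<^sup>2\<^sup>k)\<close>, and \<open>\<mu>\<^sub>n = 1 / \<omega>\<^sub>n\<close>. Since \<open>\<omega>\<close> is strictly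
  increasing (\<open>symbol_less_Suc\<close>), the linearisation \<open>\<mu>\<^sub>n L - 1\<close> at \<open>(\<mu>\<^sub>n, 0)\<close> annihilates exactly the
  multiples of \<open>c = cos (n t)\<close> and is invertible on the remaining cosines.

  With \<open>\<mu> = \<mu>\<^sub>n + m\<close> and \<open>v = s (c + w)\<close> the equation becomes, after division by \<open>s\<close>,
  \<open>m L c + (\<mu>\<^sub>n L - 1) w = (s / 2) Q (c + w, c + w) - m L w\<close>, where \<open>Q\<close> is the polarised quadratic
  part. The left-hand side has a bounded right inverse in \<open>(m, w)\<close> (\<open>bif_inverse_right\<close>), so the
  equation is a fixed-point problem for \<open>(m, w)\<close> with parameter \<open>s\<close>, contractive near the origin.
  Its solutions form a \<open>C\<^sup>1\<close> curve through the origin (\<open>C1_fixed_point_curve\<close>); \<open>w \<rightarrow> 0\<close>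
  gives \<open>v = s c + o(s)\<close>, and \<open>\<mu> = \<mu>\<^sub>n + o(s)\<close> holds because \<open>Q (c, c)\<close> contains only the frequencies
  \<open>0\<close> and \<open>2 n\<close> (\<open>fst_bif_inverse_quad_kernel\<close>).

  The fixed point is not sought in the Sobolev space itself but in a smaller Banach space, that of
  cosine series \<open>\<Sum>k. a\<^sub>k cos (k t) / (1 + k)\<close> with \<open>a \<in> \<ell>\<^sup>1\<close>. Its completeness is elementary, it
  embeds continuously into \<open>even_H0\<close> (\<open>bounded_linear_cos_series\<close>), products of cosines stay in
  \<open>\<ell>\<^sup>1\<close> trivially, and bounded operators on \<open>\<ell>\<^sup>1\<close> are determined by their values on single
  cosines. In this way the equation is transferred to coefficient sequences
  (\<open>babenko_F_cos_series\<close>), and the resulting curve is mapped back into \<open>even_H0\<close>.\<close>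

section \<open>Absolutely summable sequences\<close>

text \<open>Coefficient sequences of cosine series live in this space. It is complete, which makes contraction
  arguments available, and bounded linear maps out of it can be prescribed on the unit sequences.\<close>

typedef ell1 = "{a :: nat \<Rightarrow> real. summable (\<lambda>k. \<bar>a k\<bar>)}"
  morphisms coeff Abs_ell1
  by (rule exI[of _ "\<lambda>_. 0"]) simp

setup_lifting type_definition_ell1

instantiation ell1 :: real_vector
begin

lift_definition zero_ell1 :: ell1 is "\<lambda>_. 0"
  by simp

lift_definition plus_ell1 :: "ell1 \<Rightarrow> ell1 \<Rightarrow> ell1" is "\<lambda>a b k. a k + b k"
proof -
  fix a b :: "nat \<Rightarrow> real" assume "summable (\<lambda>k. \<bar>a k\<bar>)" "summable (\<lambda>k. \<bar>b k\<bar>)"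
  from summable_add[OF this] show "summable (\<lambda>k. \<bar>a k + b k\<bar>)"
    by (rule summable_comparison_test'[where N = 0]) (simp add: abs_triangle_ineq)
qed

lift_definition uminus_ell1 :: "ell1 \<Rightarrow> ell1" is "\<lambda>a k. - a k"
  by simp

lift_definition minus_ell1 :: "ell1 \<Rightarrow> ell1 \<Rightarrow> ell1" is "\<lambda>a b k. a k - b k"
proof -
  fix a b :: "nat \<Rightarrow> real" assume "summable (\<lambda>k. \<bar>a k\<bar>)" "summable (\<lambda>k. \<bar>b k\<bar>)"
  from summable_add[OF this] show "summable (\<lambda>k. \<bar>a k - b k\<bar>)"
    by (rule summable_comparison_test'[where N = 0]) (simp add: abs_triangle_ineq4)
qed

lift_definition scaleR_ell1 :: "real \<Rightarrow> ell1 \<Rightarrow> ell1" is "\<lambda>c a k. c * a k"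
  by (simp add: abs_mult summable_mult)

instance
  by standard (transfer; simp add: fun_eq_iff algebra_simps)+

end

instantiation ell1 :: real_normed_vector
begin

definition norm_ell1 :: "ell1 \<Rightarrow> real" where
  "norm_ell1 a = (\<Sum>k. \<bar>coeff a k\<bar>)"

definition sgn_ell1 :: "ell1 \<Rightarrow> ell1" where
  "sgn_ell1 a = a /\<^sub>R norm a"

definition dist_ell1 :: "ell1 \<Rightarrow> ell1 \<Rightarrow> real" where
  "dist_ell1 a b = norm (a - b)"

definition uniformity_ell1 :: "(ell1 \<times> ell1) filter" where
  "uniformity_ell1 = (INF e\<in>{0<..}. principal {(a, b). dist a b < e})"

definition open_ell1 :: "ell1 set \<Rightarrow> bool" where
  "open_ell1 U \<longleftrightarrow> (\<forall>a\<in>U. \<forall>\<^sub>F (a', b) in uniformity. a' = a \<longrightarrow> b \<in> U)"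

instance
proof
  fix a b :: ell1 and x :: real
  have s: "summable (\<lambda>k. \<bar>coeff a k\<bar>)" for a
    using coeff[of a] by simp
  show "(norm a = 0) = (a = 0)"
    unfolding norm_ell1_def using suminf_eq_zero_iff[OF s[of a]]
    by (auto simp: coeff_inject[symmetric] zero_ell1.rep_eq fun_eq_iff)
  show "norm (a + b) \<le> norm a + norm b"
    unfolding norm_ell1_def suminf_add[OF s s]
    by (intro suminf_le s summable_add) (auto simp: plus_ell1.rep_eq)
  show "norm (x *\<^sub>R a) = \<bar>x\<bar> * norm a"
    unfolding norm_ell1_def by (simp add: scaleR_ell1.rep_eq abs_mult suminf_mult s)
qed (fact sgn_ell1_def dist_ell1_def uniformity_ell1_def open_ell1_def)+

end

lemma summable_abs_coeff: "summable (\<lambda>k. \<bar>coeff a k\<bar>)"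
  using coeff[of a] by simp

lemma coeff_simps [simp]:
  "coeff 0 k = 0" "coeff (a + b) k = coeff a k + coeff b k"
  "coeff (a - b) k = coeff a k - coeff b k" "coeff (c *\<^sub>R a) k = c * coeff a k"
  by (simp_all add: zero_ell1.rep_eq plus_ell1.rep_eq minus_ell1.rep_eq scaleR_ell1.rep_eq)

lemma sum_abs_coeff_le_norm: "finite K \<Longrightarrow> (\<Sum>k\<in>K. \<bar>coeff a k\<bar>) \<le> norm a"
  unfolding norm_ell1_def by (intro sum_le_suminf summable_abs_coeff) auto

lemma abs_coeff_le_norm: "\<bar>coeff a k\<bar> \<le> norm a"
  using sum_abs_coeff_le_norm[of "{k}" a] by simp

lemma bounded_linear_coeff: "bounded_linear (\<lambda>a. coeff a k)"
  by (rule bounded_linear_intro[where K = 1]) (auto simp: abs_coeff_le_norm)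

lemma norm_ell1_le:
  assumes "\<And>n. (\<Sum>k<n. \<bar>coeff a k\<bar>) \<le> e"
  shows "norm a \<le> e"
  unfolding norm_ell1_def using assms by (intro suminf_le_const summable_abs_coeff)

instance ell1 :: banach
proof
  fix X :: "nat \<Rightarrow> ell1" assume X: "Cauchy X"
  have "Cauchy (\<lambda>n. coeff (X n) k)" for k
    by (rule bounded_linear.Cauchy[OF bounded_linear_coeff X])
  then have "\<exists>l. (\<lambda>n. coeff (X n) k) \<longlonglongrightarrow> l" for k
    using Cauchy_convergent convergent_def by blast
  then obtain a where a: "\<And>k. (\<lambda>n. coeff (X n) k) \<longlonglongrightarrow> a k"
    by metis
  have tail: "\<exists>N. \<forall>m\<ge>N. \<forall>K. (\<Sum>k<K. \<bar>coeff (X m) k - a k\<bar>) \<le> e" if "e > 0" for e :: real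
  proof -
    obtain N where N: "\<And>m n. m \<ge> N \<Longrightarrow> n \<ge> N \<Longrightarrow> norm (X m - X n) < e"
      using CauchyD[OF X \<open>e > 0\<close>] by blast
    have "(\<Sum>k<K. \<bar>coeff (X m) k - a k\<bar>) \<le> e" if "m \<ge> N" for m K
    proof (rule LIMSEQ_le_const2)
      show "(\<lambda>n. \<Sum>k<K. \<bar>coeff (X m) k - coeff (X n) k\<bar>) \<longlonglongrightarrow> (\<Sum>k<K. \<bar>coeff (X m) k - a k\<bar>)"
        by (intro tendsto_intros a)
      have "(\<Sum>k<K. \<bar>coeff (X m) k - coeff (X n) k\<bar>) \<le> e" if "n \<ge> N" for n
        using sum_abs_coeff_le_norm[of "{..<K}" "X m - X n"] N[OF \<open>m \<ge> N\<close> that] by simp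
      then show "\<exists>M. \<forall>n\<ge>M. (\<Sum>k<K. \<bar>coeff (X m) k - coeff (X n) k\<bar>) \<le> e" by blast
    qed
    then show ?thesis by blast
  qed
  obtain N where N: "\<And>K. (\<Sum>k<K. \<bar>coeff (X N) k - a k\<bar>) \<le> 1"
    using tail[of 1] by auto
  have "summable (\<lambda>k. \<bar>coeff (X N) k - a k\<bar>)"
    using N by (intro summableI_nonneg_bounded[where x = 1]) auto
  from summable_add[OF this summable_abs_coeff[of "X N"]] have "summable (\<lambda>k. \<bar>a k\<bar>)"
    by (rule summable_comparison_test') auto
  then have A: "coeff (Abs_ell1 a) = a" by (simp add: Abs_ell1_inverse)
  have "X \<longlonglongrightarrow> Abs_ell1 a"
  proof (rule LIMSEQ_I)
    fix e :: real assume "e > 0"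
    then obtain N where "\<And>m K. m \<ge> N \<Longrightarrow> (\<Sum>k<K. \<bar>coeff (X m) k - a k\<bar>) \<le> e / 2"
      using tail[of "e / 2"] by auto
    then have "norm (X m - Abs_ell1 a) \<le> e / 2" if "m \<ge> N" for m
      using that by (intro norm_ell1_le) (simp add: A)
    with \<open>e > 0\<close> show "\<exists>N. \<forall>m\<ge>N. norm (X m - Abs_ell1 a) < e"
      by (intro exI[of _ N]) force
  qed
  then show "convergent X" by (auto simp: convergent_def)
qed

lift_definition unit_ell1 :: "nat \<Rightarrow> ell1" is "\<lambda>i k. if k = i then 1 else 0"
proof -
  fix i :: nat
  show "summable (\<lambda>k. \<bar>if k = i then 1 else 0 :: real\<bar>)"
    by (rule summable_finite[of "{i}"]) auto
qed

lemma coeff_unit: "coeff (unit_ell1 i) k = (if k = i then 1 else 0)"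
  by (simp add: unit_ell1.rep_eq)

lemma norm_unit [simp]: "norm (unit_ell1 i) = 1"
proof -
  have "(\<lambda>k. \<bar>coeff (unit_ell1 i) k\<bar>) = (\<lambda>k. if k = i then 1 else 0)"
    by (auto simp: coeff_unit)
  then have "(\<lambda>k. \<bar>coeff (unit_ell1 i) k\<bar>) sums 1"
    using sums_single[of i "\<lambda>_. 1::real"] by simp
  then show ?thesis unfolding norm_ell1_def by (simp add: sums_iff)
qed

lemma unit_expansion: "(\<lambda>k. coeff a k *\<^sub>R unit_ell1 k) sums a"
proof -
  have lim: "(\<lambda>n. \<Sum>k. \<bar>coeff a (k + n)\<bar>) \<longlonglongrightarrow> 0"
    using suminf_exist_split2[OF summable_abs_coeff[of a]] by simp
  have le: "norm ((\<Sum>k<n. coeff a k *\<^sub>R unit_ell1 k) - a) \<le> (\<Sum>k. \<bar>coeff a (k + n)\<bar>)" for n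
  proof -
    define d where "d = (\<Sum>k<n. coeff a k *\<^sub>R unit_ell1 k) - a"
    have sum: "coeff (\<Sum>k\<in>K. x k) j = (\<Sum>k\<in>K. coeff (x k) j)" for K j and x :: "nat \<Rightarrow> ell1"
      by (rule linear_sum) (use bounded_linear_coeff bounded_linear.linear in blast)
    have d: "coeff d j = (if j < n then 0 else - coeff a j)" for j
    proof -
      have "coeff d j = (\<Sum>k<n. if j = k then coeff a k else 0) - coeff a j"
        unfolding d_def coeff_simps sum by (intro arg_cong2[of _ _ _ _ minus] sum.cong) (auto simp: coeff_unit)
      then show ?thesis by simp
    qed
    have "norm d = (\<Sum>k. \<bar>coeff d (k + n)\<bar>) + (\<Sum>k<n. \<bar>coeff d k\<bar>)"
      unfolding norm_ell1_def by (rule suminf_split_initial_segment[OF summable_abs_coeff])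
    then show ?thesis unfolding d_def[symmetric] by (simp add: d)
  qed
  have "(\<lambda>n. (\<Sum>k<n. coeff a k *\<^sub>R unit_ell1 k) - a) \<longlonglongrightarrow> 0"
    by (rule Lim_null_comparison[OF always_eventually[OF allI[OF le]] lim])
  then show ?thesis unfolding sums_def by (rule LIM_zero_cancel)
qed

text \<open>Every identity between operators on cosine series is reduced by this rule to an identity
  between single cosines.\<close>

lemma bounded_linear_ell1_eqI:
  fixes f g :: "ell1 \<Rightarrow> 'b::real_normed_vector"
  assumes "bounded_linear f" "bounded_linear g" "\<And>k. f (unit_ell1 k) = g (unit_ell1 k)"
  shows "f a = g a"
proof -
  have "(\<lambda>k. h (coeff a k *\<^sub>R unit_ell1 k)) sums h a" if "bounded_linear h" for h :: "ell1 \<Rightarrow> 'b"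
    by (rule bounded_linear.sums[OF that unit_expansion])
  from this[OF assms(1)] this[OF assms(2)] show ?thesis
    using assms by (simp add: bounded_linear.linear linear_scale sums_unique2)
qed

text \<open>The universal property of \<open>\<ell>\<^sup>1\<close>: a bounded family indexed by the unit sequences extends
  to a bounded linear map. Iterating it yields bounded bilinear maps.\<close>

definition lin_ext :: "(nat \<Rightarrow> 'b::banach) \<Rightarrow> ell1 \<Rightarrow>\<^sub>L 'b" where
  "lin_ext y = Blinfun (\<lambda>a. \<Sum>k. coeff a k *\<^sub>R y k)"

lemma
  fixes y :: "nat \<Rightarrow> 'b::banach"
  assumes y: "\<And>k. norm (y k) \<le> C"
  shows lin_ext_sums: "(\<lambda>k. coeff a k *\<^sub>R y k) sums lin_ext y a"
    and norm_lin_ext_apply: "norm (lin_ext y a) \<le> C * norm a"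
    and lin_ext_unit: "lin_ext y (unit_ell1 i) = y i"
    and norm_lin_ext: "norm (lin_ext y) \<le> C"
proof -
  have C: "0 \<le> C" using y[of 0] norm_ge_zero order_trans by blast
  have bd: "norm (coeff a k *\<^sub>R y k) \<le> C * \<bar>coeff a k\<bar>" for a k
    using y[of k] by (simp add: mult.commute mult_right_mono)
  have s: "summable (\<lambda>k. C * \<bar>coeff a k\<bar>)" for a
    by (intro summable_mult summable_abs_coeff)
  have s': "summable (\<lambda>k. coeff a k *\<^sub>R y k)" for a
    by (rule summable_comparison_test'[OF s bd])
  have n: "norm (\<Sum>k. coeff a k *\<^sub>R y k) \<le> C * norm a" for a
    using norm_suminf_le[OF bd s, of a] unfolding norm_ell1_def
    by (simp add: suminf_mult[OF summable_abs_coeff])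
  have "bounded_linear (\<lambda>a. \<Sum>k. coeff a k *\<^sub>R y k)"
  proof (rule bounded_linear_intro[where K = C])
    show "(\<Sum>k. coeff (a + b) k *\<^sub>R y k) = (\<Sum>k. coeff a k *\<^sub>R y k) + (\<Sum>k. coeff b k *\<^sub>R y k)" for a b
      by (subst suminf_add[OF s' s']) (simp add: scaleR_add_left)
    show "(\<Sum>k. coeff (c *\<^sub>R a) k *\<^sub>R y k) = c *\<^sub>R (\<Sum>k. coeff a k *\<^sub>R y k)" for c a
      by (simp add: suminf_scaleR_right[OF s'])
  qed (use n in \<open>simp add: mult.commute\<close>)
  then have e: "lin_ext y a = (\<Sum>k. coeff a k *\<^sub>R y k)" for a
    by (simp add: lin_ext_def bounded_linear_Blinfun_apply)
  show "(\<lambda>k. coeff a k *\<^sub>R y k) sums lin_ext y a" for a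
    unfolding e by (rule summable_sums[OF s'])
  show "norm (lin_ext y a) \<le> C * norm a" for a unfolding e by (rule n)
  then show "norm (lin_ext y) \<le> C" using C by (rule norm_blinfun_bound[rotated])
  have "(\<lambda>k. coeff (unit_ell1 i) k *\<^sub>R y k) = (\<lambda>k. if k = i then y k else 0)"
    by (auto simp: coeff_unit)
  then have "(\<lambda>k. coeff (unit_ell1 i) k *\<^sub>R y k) sums y i"
    using sums_single[of i y] by simp
  then show "lin_ext y (unit_ell1 i) = y i" unfolding e by (simp add: sums_iff)
qed

section \<open>A fixed-point form of the implicit function theorem\<close>

text \<open>A displacement \<open>u\<close> of fixed points is an error \<open>e\<close>, caused by the change of the map, plus a
  contracted image of \<open>u\<close>, which can be absorbed. Continuity and differentiability of the
  fixed-point curve below both come from this estimate.\<close>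

lemma contraction_displacement:
  fixes u e :: "'z::real_normed_vector"
  assumes "norm (u - e) \<le> norm u / 2"
  shows "norm u \<le> 2 * norm e"
  using assms norm_triangle_sub[of u e] by simp

text \<open>Near the origin the partial derivative of \<open>\<Phi>\<close> in the second variable has norm at most \<open>1/2\<close>, so
  each map \<open>\<Phi> (s, _)\<close> contracts a fixed small ball and has a unique fixed point \<open>z s\<close> in it. The
  derivative of \<open>z\<close> has to satisfy the differentiated equation
  \<open>y = \<partial>\<^sub>s\<Phi> + \<partial>\<^sub>z\<Phi> y\<close>, again a contraction; its solution is shown to be the derivative and to
  depend continuously on \<open>s\<close>.\<close>

lemma C1_fixed_point_curve:
  fixes \<Phi> :: "real \<times> 'z::banach \<Rightarrow> 'z" and \<Phi>' :: "real \<times> 'z \<Rightarrow> (real \<times> 'z) \<Rightarrow>\<^sub>L 'z"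
  assumes deriv: "\<And>x. (\<Phi> has_derivative \<Phi>' x) (at x)"
    and cont: "continuous_on UNIV \<Phi>'"
    and zero: "\<Phi> (0, 0) = 0" and flat: "\<And>k. \<Phi>' (0, 0) (0, k) = 0"
  obtains \<epsilon> z z' where "\<epsilon> > 0" "\<And>s. \<bar>s\<bar> < \<epsilon> \<Longrightarrow> z s = \<Phi> (s, z s)" "z 0 = 0"
    "\<And>s. \<bar>s\<bar> < \<epsilon> \<Longrightarrow> (z has_vector_derivative z' s) (at s)"
    "continuous_on {-\<epsilon><..<\<epsilon>} z'" "z' 0 = \<Phi>' (0, 0) (1, 0)"
proof -
  have isCont\<Phi>': "isCont \<Phi>' x" for x
    by (rule continuous_on_eq_continuous_at[OF open_UNIV, THEN iffD1, OF cont, rule_format]) (rule UNIV_I)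
  then obtain \<rho> where \<rho>: "\<rho> > 0" "\<And>x. norm x < \<rho> \<Longrightarrow> norm (\<Phi>' x - \<Phi>' 0) < 1 / 2"
    using isCont\<Phi>'[of 0, unfolded continuous_at_eps_delta, rule_format, of "1/2"]
    by (auto simp: dist_norm)
  \<comment> \<open>A third suffices because \<open>\<parallel>(s, z)\<parallel> \<le> \<bar>s\<bar> + \<parallel>z\<parallel>\<close>.\<close>
  define \<delta> where "\<delta> = \<rho> / 3"
  have \<delta>: "\<delta> > 0" using \<rho> by (simp add: \<delta>_def)
  have half: "norm (\<Phi>' (s, z) (0, k)) \<le> norm k / 2" if "\<bar>s\<bar> \<le> \<delta>" "norm z \<le> \<delta>" for s z k
  proof -
    have "norm (s, z) \<le> \<bar>s\<bar> + norm z" using norm_Pair_le[of s z] by simp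
    also have "\<dots> < \<rho>" using that \<rho> by (simp add: \<delta>_def)
    finally have "norm (\<Phi>' (s, z) - \<Phi>' 0) \<le> 1 / 2" using \<rho>(2) by force
    moreover have "\<Phi>' (s, z) (0, k) = (\<Phi>' (s, z) - \<Phi>' 0) (0, k)"
      using flat[of k] by (simp add: blinfun.diff_left zero_prod_def)
    moreover have "norm ((\<Phi>' (s, z) - \<Phi>' 0) (0, k)) \<le> norm (\<Phi>' (s, z) - \<Phi>' 0) * norm (0::real, k)"
      by (rule norm_blinfun)
    ultimately show ?thesis
      using mult_right_mono[of "norm (\<Phi>' (s, z) - \<Phi>' 0)" "1/2" "norm k"] by (simp add: norm_Pair)
  qed
  have contr: "norm (\<Phi> (s, z) - \<Phi> (s, w)) \<le> norm (z - w) / 2"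
    if s: "\<bar>s\<bar> \<le> \<delta>" and zw: "norm z \<le> \<delta>" "norm w \<le> \<delta>" for s z w
  proof -
    have "norm (\<Phi> (s, z) - \<Phi> (s, w)) \<le> 1 / 2 * norm (z - w)"
    proof (rule differentiable_bound[where S = "cball 0 \<delta>" and f' = "\<lambda>z k. \<Phi>' (s, z) (0, k)"])
      fix x :: 'z assume x: "x \<in> cball 0 \<delta>"
      have "((\<lambda>z. (s, z)) has_derivative (\<lambda>k. (0, k))) (at x within cball 0 \<delta>)"
        by (auto intro!: derivative_eq_intros)
      from has_derivative_compose[OF this deriv]
      show "((\<lambda>z. \<Phi> (s, z)) has_derivative (\<lambda>k. \<Phi>' (s, x) (0, k))) (at x within cball 0 \<delta>)" .
      show "onorm (\<lambda>k. \<Phi>' (s, x) (0, k)) \<le> 1 / 2"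
        by (rule onorm_bound) (use half[OF s] x in simp_all)
    qed (use zw in simp_all)
    then show ?thesis by simp
  qed
  have cont\<Phi>: "isCont (\<lambda>s. \<Phi> (s, z)) s" for s z
    by (rule isCont_o2[OF _ has_derivative_continuous[OF deriv]]) (intro continuous_intros)
  obtain \<eta> where \<eta>: "\<eta> > 0" "\<And>s. \<bar>s\<bar> < \<eta> \<Longrightarrow> norm (\<Phi> (s, 0)) < \<delta> / 2"
    using cont\<Phi>[of 0 0, unfolded continuous_at_eps_delta, rule_format, of "\<delta> / 2"] \<delta> zero
    by (auto simp: dist_norm)
  define \<epsilon> where "\<epsilon> = min \<delta> \<eta>"
  have \<epsilon>: "\<epsilon> > 0" using \<delta> \<eta> by (simp add: \<epsilon>_def)
  have fix_z: "\<exists>!z\<in>cball 0 \<delta>. \<Phi> (s, z) = z" if s: "\<bar>s\<bar> < \<epsilon>" for s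
  proof (rule Banach_fix[where c = "1/2"])
    have s\<delta>: "\<bar>s\<bar> \<le> \<delta>" using s by (simp add: \<epsilon>_def)
    show "(\<lambda>z. \<Phi> (s, z)) ` cball 0 \<delta> \<subseteq> cball 0 \<delta>"
    proof safe
      fix z :: 'z assume z: "z \<in> cball 0 \<delta>"
      have "norm (\<Phi> (s, z)) \<le> norm (\<Phi> (s, z) - \<Phi> (s, 0)) + norm (\<Phi> (s, 0))"
        using norm_triangle_sub[of "\<Phi> (s, z)" "\<Phi> (s, 0)"] by simp
      also have "\<dots> \<le> \<delta> / 2 + \<delta> / 2"
        using contr[OF s\<delta>, of z 0] \<eta>(2)[of s] z s \<delta> by (intro add_mono) (auto simp: \<epsilon>_def)
      finally show "\<Phi> (s, z) \<in> cball 0 \<delta>" by simp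
    qed
    show "dist (\<Phi> (s, z)) (\<Phi> (s, w)) \<le> 1 / 2 * dist z w" if "z \<in> cball 0 \<delta>" "w \<in> cball 0 \<delta>" for z w
      using contr[OF s\<delta>, of z w] that by (simp add: dist_norm)
  qed (use \<delta> in \<open>auto simp: complete_eq_closed\<close>)
  define z where "z s = (THE z. z \<in> cball 0 \<delta> \<and> \<Phi> (s, z) = z)" for s
  have z: "norm (z s) \<le> \<delta>" "\<Phi> (s, z s) = z s" if "\<bar>s\<bar> < \<epsilon>" for s
    using theI'[OF fix_z[OF that]] by (auto simp: z_def)
  have z0: "z 0 = 0"
    unfolding z_def using fix_z[of 0] zero \<epsilon> \<delta> by (intro the1_equality) auto
  have s\<delta>: "\<bar>s\<bar> \<le> \<delta>" if "\<bar>s\<bar> < \<epsilon>" for s using that by (simp add: \<epsilon>_def)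
  have fix_y: "\<exists>!y. \<Phi>' (s, z s) (1, y) = y" if s: "\<bar>s\<bar> < \<epsilon>" for s
  proof (rule banach_fix_type[where c = "1/2"])
    show "\<forall>x y. dist (\<Phi>' (s, z s) (1, x)) (\<Phi>' (s, z s) (1, y)) \<le> 1 / 2 * dist x y"
      using half[OF s\<delta>[OF s] z(1)[OF s]] by (simp add: dist_norm flip: blinfun.diff_right)
  qed auto
  \<comment> \<open>The candidate for the derivative of \<open>z\<close> at \<open>s\<close>, by implicit differentiation.\<close>
  define y where "y s = (THE y. \<Phi>' (s, z s) (1, y) = y)" for s
  have y: "\<Phi>' (s, z s) (1, y s) = y s" if "\<bar>s\<bar> < \<epsilon>" for s
    unfolding y_def by (rule theI'[OF fix_y[OF that]])
  have near: "\<forall>\<^sub>F s' in at s. \<bar>s'\<bar> < \<epsilon>" if "\<bar>s\<bar> < \<epsilon>" for s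
    using that eventually_at_in_open'[of "{-\<epsilon><..<\<epsilon>}" s] by (simp add: abs_less_iff minus_less_iff conj_commute)
  have z_disp: "norm (z s' - z s) \<le> 2 * norm (\<Phi> (s', z s) - \<Phi> (s, z s))"
    if "\<bar>s\<bar> < \<epsilon>" "\<bar>s'\<bar> < \<epsilon>" for s s'
    using contr[OF s\<delta>[OF that(2)] z(1)[OF that(2)] z(1)[OF that(1)]] z(2) that
    by (intro contraction_displacement) simp
  have z_deriv: "(z has_vector_derivative y s) (at s)" if s: "\<bar>s\<bar> < \<epsilon>" for s
  proof -
    define x where "x = (s, z s)"
    define R where "R p = \<Phi> p - \<Phi> x - \<Phi>' x (p - x)" for p
    have R: "((\<lambda>p. norm (R p) / norm (p - x)) \<longlongrightarrow> 0) (at x)"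
      using deriv[of x] unfolding has_derivative_iff_norm R_def by (rule conjunct2)
    \<comment> \<open>Over \<open>nhds x\<close> rather than \<open>at x\<close>, because \<open>(s', z s)\<close> or \<open>(s', z s')\<close> is substituted for \<open>p\<close>.\<close>
    have Re: "\<forall>\<^sub>F p in nhds x. norm (R p) \<le> e * norm (p - x)" if "e > 0" for e
    proof -
      have "\<forall>\<^sub>F p in at x. norm (R p) / norm (p - x) < e"
        using order_tendstoD(2)[OF R that] .
      then have "\<forall>\<^sub>F p in at x. norm (R p) \<le> e * norm (p - x)"
        using eventually_neq_at_within[of x x UNIV]
        by eventually_elim (auto simp: divide_simps split: if_splits)
      then show ?thesis
        unfolding eventually_at_filter by (rule eventually_mono) (auto simp: R_def blinfun.zero_right)
    qed
    define C where "C = 2 * (norm (\<Phi>' x) + 1)"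
    have C: "C > 0" by (simp add: C_def add_nonneg_pos)
    have lip: "\<forall>\<^sub>F s' in at s. norm (z s' - z s) \<le> C * \<bar>s' - s\<bar>"
    proof -
      have "filterlim (\<lambda>s'. (s', z s)) (nhds x) (at s)"
        unfolding x_def by (intro tendsto_intros)
      then have "\<forall>\<^sub>F s' in at s. norm (R (s', z s)) \<le> 1 * norm ((s', z s) - x)"
        by (rule eventually_compose_filterlim[OF Re, rotated]) simp
      then show ?thesis using near[OF s]
      proof eventually_elim
        case (elim s')
        have "\<Phi> (s', z s) - \<Phi> (s, z s) = R (s', z s) + \<Phi>' x (s' - s, 0)"
          by (simp add: R_def x_def)
        then have "norm (\<Phi> (s', z s) - \<Phi> (s, z s)) \<le> \<bar>s' - s\<bar> + norm (\<Phi>' x) * \<bar>s' - s\<bar>"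
          using elim(1) norm_blinfun[of "\<Phi>' x" "(s' - s, 0)"]
            norm_triangle_ineq[of "R (s', z s)" "\<Phi>' x (s' - s, 0)"]
          by (simp add: x_def norm_Pair)
        with z_disp[OF s elim(2)] show ?case by (simp add: C_def algebra_simps)
      qed
    qed
    have ztend: "(z \<longlongrightarrow> z s) (at s)"
    proof (rule LIM_zero_cancel, rule Lim_null_comparison[OF lip])
      show "((\<lambda>s'. C * \<bar>s' - s\<bar>) \<longlongrightarrow> 0) (at s)"
        by (auto intro!: tendsto_eq_intros)
    qed
    have "((\<lambda>s'. norm (z s' - z s - (s' - s) *\<^sub>R y s) / norm (s' - s)) \<longlongrightarrow> 0) (at s)"
    proof (rule tendstoI)
      fix e :: real assume e: "e > 0"
      define e' where "e' = e / (4 * (1 + C))"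
      have e': "e' > 0" using e C by (simp add: e'_def)
      have "filterlim (\<lambda>s'. (s', z s')) (nhds x) (at s)"
        unfolding x_def by (intro tendsto_intros ztend)
      then have "\<forall>\<^sub>F s' in at s. norm (R (s', z s')) \<le> e' * norm ((s', z s') - x)"
        by (rule eventually_compose_filterlim[OF Re[OF e']])
      moreover have "\<forall>\<^sub>F s' in at s. s' \<noteq> s" by (rule eventually_neq_at_within)
      ultimately have "\<forall>\<^sub>F s' in at s. norm (z s' - z s - (s' - s) *\<^sub>R y s) / norm (s' - s) < e"
        using lip near[OF s]
      proof eventually_elim
        case (elim s')
        define u where "u = z s' - z s - (s' - s) *\<^sub>R y s"
        have A: "z s' - z s = R (s', z s') + \<Phi>' x (s' - s, z s' - z s)"
          using z(2)[OF s] z(2)[OF elim(4)] by (simp add: R_def x_def)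
        have B: "(s' - s) *\<^sub>R y s = \<Phi>' x (s' - s, (s' - s) *\<^sub>R y s)"
          using y[OF s] blinfun.scaleR_right[of "\<Phi>' x" "s' - s" "(1, y s)"] by (simp add: x_def)
        have "u = R (s', z s') + \<Phi>' x (s' - s, z s' - z s) - \<Phi>' x (s' - s, (s' - s) *\<^sub>R y s)"
          unfolding u_def by (rule arg_cong2[of _ _ _ _ minus, OF A B])
        then have "u - R (s', z s') = \<Phi>' x (s' - s, z s' - z s) - \<Phi>' x (s' - s, (s' - s) *\<^sub>R y s)"
          by simp
        also have "\<dots> = \<Phi>' x (0, u)"
          by (simp add: u_def flip: blinfun.diff_right)
        finally have "norm (u - R (s', z s')) \<le> norm u / 2"
          using half[OF s\<delta>[OF s] z(1)[OF s]] by (simp add: x_def)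
        then have "norm u \<le> 2 * norm (R (s', z s'))" by (rule contraction_displacement)
        also have "norm (R (s', z s')) \<le> e' * norm (s' - s, z s' - z s)"
          using elim(1) by (simp add: x_def)
        also have "norm (s' - s, z s' - z s) \<le> (1 + C) * \<bar>s' - s\<bar>"
          using norm_Pair_le[of "s' - s" "z s' - z s"] elim(3) by (simp add: algebra_simps)
        finally have "norm u \<le> 2 * (e' * ((1 + C) * \<bar>s' - s\<bar>))" using e' by simp
        also have "\<dots> = e / 2 * \<bar>s' - s\<bar>" using C by (simp add: e'_def field_simps)
        also have "\<dots> < e * \<bar>s' - s\<bar>" using e elim(2) by simp
        finally show ?case using elim(2) by (simp add: u_def divide_simps)
      qed
      then show "\<forall>\<^sub>F s' in at s. dist (norm (z s' - z s - (s' - s) *\<^sub>R y s) / norm (s' - s)) 0 < e"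
        by simp
    qed
    then show ?thesis
      unfolding has_vector_derivative_def has_derivative_iff_norm
      by (auto intro!: bounded_linear_intros)
  qed
  have zc: "continuous_on {-\<epsilon><..<\<epsilon>} z"
    by (intro continuous_at_imp_continuous_on ballI has_vector_derivative_continuous[OF z_deriv]) auto
  have yc: "continuous_on {-\<epsilon><..<\<epsilon>} y"
    unfolding continuous_on
  proof
    fix s assume "s \<in> {-\<epsilon><..<\<epsilon>}"
    then have s: "\<bar>s\<bar> < \<epsilon>" by auto
    have zc': "(z \<longlongrightarrow> z s) (at s)"
      using has_vector_derivative_continuous[OF z_deriv[OF s]] by (simp add: isCont_def)
    have "((\<lambda>s'. \<Phi>' (s', z s')) \<longlongrightarrow> \<Phi>' (s, z s)) (at s)"
      by (rule isCont_tendsto_compose[OF isCont\<Phi>']) (intro tendsto_intros zc')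
    then have "((\<lambda>s'. 2 * norm ((\<Phi>' (s', z s') - \<Phi>' (s, z s)) (1, y s))) \<longlongrightarrow> 0) (at s)"
      by (auto intro!: tendsto_eq_intros)
    moreover have "\<forall>\<^sub>F s' in at s. norm (y s' - y s) \<le> 2 * norm ((\<Phi>' (s', z s') - \<Phi>' (s, z s)) (1, y s))"
      using near[OF s]
    proof eventually_elim
      case (elim s')
      have "y s' - y s - (\<Phi>' (s', z s') - \<Phi>' (s, z s)) (1, y s) = \<Phi>' (s', z s') (0, y s' - y s)"
        using y[OF s] y[OF elim] blinfun.diff_right[of "\<Phi>' (s', z s')" "(1, y s')" "(1, y s)"]
        by (simp add: blinfun.diff_left)
      then show ?case
        using half[OF s\<delta>[OF elim] z(1)[OF elim]] by (intro contraction_displacement) simp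
    qed
    ultimately have "(y \<longlongrightarrow> y s) (at s)"
      by (rule LIM_zero_cancel[OF Lim_null_comparison[rotated]])
    then show "(y \<longlongrightarrow> y s) (at s within {-\<epsilon><..<\<epsilon>})" by (rule tendsto_within_subset) simp
  qed
  have "y 0 = \<Phi>' (0, 0) (1, 0)"
    using y[of 0] \<epsilon> z0 flat[of "y 0"] blinfun.add_right[of "\<Phi>' (0, 0)" "(1, 0)" "(0, y 0)"] by simp
  with that[OF \<epsilon> _ z0 z_deriv yc] z(2) show thesis by simp
qed

section \<open>Absolutely convergent function series\<close>

text \<open>Evaluation at \<open>t\<close> is the linear extension of \<open>k \<mapsto> c k t\<close>, so the sup bound and linearity in the
  coefficients come for free.\<close>

definition series :: "(nat \<Rightarrow> real \<Rightarrow> real) \<Rightarrow> ell1 \<Rightarrow> real \<Rightarrow> real" where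
  "series c a t = lin_ext (\<lambda>k. c k t) a"

lemma
  fixes c :: "nat \<Rightarrow> real \<Rightarrow> real"
  assumes c: "\<And>k t. \<bar>c k t\<bar> \<le> 1"
  shows series_sums: "(\<lambda>k. coeff a k * c k t) sums series c a t"
    and abs_series_le: "\<bar>series c a t\<bar> \<le> norm a"
    and series_unit: "series c (unit_ell1 i) t = c i t"
  using lin_ext_sums[of "\<lambda>k. c k t" 1 a] norm_lin_ext_apply[of "\<lambda>k. c k t" 1 a]
    lin_ext_unit[of "\<lambda>k. c k t" 1 i] c by (simp_all add: series_def)

lemma series_linear:
  "series c (a + b) t = series c a t + series c b t" "series c (x *\<^sub>R a) t = x * series c a t"
  by (simp_all add: series_def blinfun.add_right blinfun.scaleR_right)

lemma continuous_on_series: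
  assumes c: "\<And>k t. \<bar>c k t\<bar> \<le> 1" and cont: "\<And>k. continuous_on UNIV (c k)"
  shows "continuous_on UNIV (series c a)"
proof (rule uniform_limit_theorem)
  have "uniform_limit UNIV (\<lambda>n t. \<Sum>k<n. coeff a k * c k t) (\<lambda>t. \<Sum>k. coeff a k * c k t) sequentially"
    by (rule Weierstrass_m_test[OF _ summable_abs_coeff[of a]])
      (use c in \<open>simp add: abs_mult mult_left_le\<close>)
  moreover have "(\<lambda>t. \<Sum>k. coeff a k * c k t) = series c a"
    using series_sums[of c, OF c] by (auto simp: sums_iff)
  ultimately show "uniform_limit UNIV (\<lambda>n t. \<Sum>k<n. coeff a k * c k t) (series c a) sequentially"
    by simp
  show "\<forall>\<^sub>F n in sequentially. continuous_on UNIV (\<lambda>t. \<Sum>k<n. coeff a k * c k t)"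
    by (intro always_eventually allI continuous_intros cont)
qed simp

lemma has_real_derivative_series:
  assumes c: "\<And>k t. \<bar>c k t\<bar> \<le> 1" and d: "\<And>k t. \<bar>d k t\<bar> \<le> 1"
    and deriv: "\<And>k t. (c k has_real_derivative d k t) (at t)"
  shows "(series c a has_real_derivative series d a t) (at t)"
proof -
  note deriv_series = has_field_derivative_series'(2)[of UNIV "\<lambda>k t. coeff a k * c k t" "\<lambda>k t. coeff a k * d k t" 0 t]
  have "((\<lambda>t. \<Sum>k. coeff a k * c k t) has_field_derivative (\<Sum>k. coeff a k * d k t)) (at t)"
  proof (rule deriv_series)
    show "uniformly_convergent_on UNIV (\<lambda>n t. \<Sum>k<n. coeff a k * d k t)"
      by (rule Weierstrass_m_test'[OF _ summable_abs_coeff[of a]])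
        (use d in \<open>simp add: abs_mult mult_left_le\<close>)
    show "summable (\<lambda>k. coeff a k * c k 0)"
      using series_sums[of c, OF c] by (rule sums_summable)
  qed (auto intro!: DERIV_cmult deriv)
  moreover have "(\<lambda>t. \<Sum>k. coeff a k * c k t) = series c a" "(\<Sum>k. coeff a k * d k t) = series d a t"
    using series_sums[of c, OF c] series_sums[of d, OF d] by (auto simp: sums_iff)
  ultimately show ?thesis by simp
qed

lemma measure_leb_pi: "measure leb_pi {-pi<..<pi} = 2 * pi"
  by (simp add: measure_restrict_space)

lemma norm_L2_eq: "norm (abs_L2 f) = sqrt (LINT t|leb_pi. (f t)\<^sup>2)" if "square_integrable f"
  using that by (simp add: norm_L2_def inner_L2.abs_eq L2_rel_def power2_eq_square)

lemma norm_abs_L2_le: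
  assumes f: "square_integrable f" and M: "\<And>t. \<bar>f t\<bar> \<le> M"
  shows "norm (abs_L2 f) \<le> sqrt (2 * pi) * M"
proof -
  have "0 \<le> M" using M[of 0] by simp
  have "(f t)\<^sup>2 \<le> M\<^sup>2" for t
    using M[of t] by (metis abs_ge_zero power2_abs power_mono)
  then have "(LINT t|leb_pi. (f t)\<^sup>2) \<le> (LINT t|leb_pi. M\<^sup>2)"
    using f finite_measure.integrable_const[OF finite_leb_pi]
    unfolding square_integrable_def by (intro integral_mono) auto
  also have "\<dots> = 2 * pi * M\<^sup>2"
    by (simp add: measure_leb_pi)
  finally have "sqrt (LINT t|leb_pi. (f t)\<^sup>2) \<le> sqrt (2 * pi * M\<^sup>2)" by simp
  then show ?thesis
    using \<open>0 \<le> M\<close> by (simp add: norm_L2_eq[OF f] real_sqrt_mult)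
qed

lemma square_integrable_series:
  assumes "\<And>k t. \<bar>c k t\<bar> \<le> 1" "\<And>k. continuous_on UNIV (c k)"
  shows "square_integrable (series c a)"
  by (intro square_integrable_continuous continuous_on_subset[OF continuous_on_series[OF assms]]) auto

lemma bounded_linear_abs_L2_series:
  assumes c: "\<And>k t. \<bar>c k t\<bar> \<le> 1" "\<And>k. continuous_on UNIV (c k)"
  shows "bounded_linear (\<lambda>a. abs_L2 (series c a))"
proof (rule bounded_linear_intro[where K = "sqrt (2 * pi)"])
  note si = square_integrable_series[OF c]
  fix a b :: ell1 and x :: real
  have "series c (a + b) = (\<lambda>t. series c a t + series c b t)"
    by (simp add: series_linear fun_eq_iff)
  then show "abs_L2 (series c (a + b)) = abs_L2 (series c a) + abs_L2 (series c b)"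
    using si by (simp add: plus_L2.abs_eq L2_rel_def)
  have "series c (x *\<^sub>R a) = (\<lambda>t. x * series c a t)"
    by (simp add: series_linear fun_eq_iff)
  then show "abs_L2 (series c (x *\<^sub>R a)) = x *\<^sub>R abs_L2 (series c a)"
    using si by (simp add: scaleR_L2.abs_eq L2_rel_def)
  show "norm (abs_L2 (series c a)) \<le> norm a * sqrt (2 * pi)"
    using norm_abs_L2_le[OF si abs_series_le[OF c(1)]] by (simp add: mult.commute)
qed

section \<open>Cosine series as elements of the function spaces\<close>

text \<open>The weight \<open>1 / (1 + k)\<close> makes both the functions and their derivatives bounded by 1, so that
  summable coefficients give \<open>C\<^sup>1\<close> functions.\<close>

definition wcos :: "nat \<Rightarrow> real \<Rightarrow> real" where
  "wcos k t = cos (real k * t) / (1 + real k)"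

definition wcos' :: "nat \<Rightarrow> real \<Rightarrow> real" where
  "wcos' k t = - real k * sin (real k * t) / (1 + real k)"

lemma abs_wcos_le: "\<bar>wcos k t\<bar> \<le> 1"
  by (auto simp: wcos_def divide_le_eq intro: order_trans[OF abs_cos_le_one])

lemma abs_wcos'_le: "\<bar>wcos' k t\<bar> \<le> 1"
proof -
  have "real k * \<bar>sin (real k * t)\<bar> \<le> real k" by (rule mult_left_le) auto
  then show ?thesis by (simp add: wcos'_def abs_mult divide_le_eq)
qed

lemma has_real_derivative_wcos: "(wcos k has_real_derivative wcos' k t) (at t)"
  unfolding wcos_def[abs_def] wcos'_def by (auto intro!: derivative_eq_intros)

lemma continuous_on_wcos: "continuous_on UNIV (wcos k)" "continuous_on UNIV (wcos' k)"
  unfolding wcos_def[abs_def] wcos'_def[abs_def] by (auto intro!: continuous_intros)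

lemmas has_real_derivative_wcos_series =
  has_real_derivative_series[OF abs_wcos_le abs_wcos'_le has_real_derivative_wcos]

lemma series_wcos_minus: "series wcos a (- t) = series wcos a t"
  by (simp add: series_def wcos_def)

text \<open>The cut-off outside \<open>[-\<pi>, \<pi>]\<close> is the normalisation used for elements of \<open>H0\<close>.\<close>

lemma wcos_series_weak_deriv:
  "has_weak_deriv (\<lambda>t. if t \<in> {-pi..pi} then series wcos a t else 0) (series wcos' a)"
proof (rule has_weak_deriv_classical)
  have "continuous_on {-pi..pi} (series wcos a)"
    by (rule continuous_on_subset[OF continuous_on_series[OF abs_wcos_le continuous_on_wcos(1)]]) simp
  then show "continuous_on {-pi..pi} (\<lambda>t. if t \<in> {-pi..pi} then series wcos a t else 0)"
    by (rule continuous_on_eq) simp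
  show "continuous_on {-pi..pi} (series wcos' a)"
    by (rule continuous_on_subset[OF continuous_on_series[OF abs_wcos'_le continuous_on_wcos(2)]]) simp
  fix t assume t: "t \<in> {-pi<..<pi}"
  show "((\<lambda>t. if t \<in> {-pi..pi} then series wcos a t else 0) has_real_derivative series wcos' a t) (at t)"
    by (rule has_field_derivative_transform_within_open[OF has_real_derivative_wcos_series, where S = "{-pi<..<pi}"])
      (use t in auto)
qed

lift_definition cos_series_H0 :: "ell1 \<Rightarrow> even_H0" is
  "\<lambda>a t. if t \<in> {-pi..pi} then series wcos a t else 0"
proof -
  fix a
  let ?v = "\<lambda>t. if t \<in> {-pi..pi} then series wcos a t else 0"
  have "abs_continuous_on {-pi..pi} ?v"
  proof (rule abs_continuous_on_lipschitz[where C = "norm a"])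
    fix s t :: real assume "s \<in> {-pi..pi}" "t \<in> {-pi..pi}"
    moreover have "norm (series wcos a s - series wcos a t) \<le> norm a * norm (s - t)"
      by (rule field_differentiable_bound[where S = UNIV and f' = "series wcos' a"])
        (use abs_series_le[OF abs_wcos'_le] has_real_derivative_wcos_series in auto)
    ultimately show "\<bar>?v s - ?v t\<bar> \<le> norm a * \<bar>s - t\<bar>" by simp
  qed
  moreover have "square_integrable (series wcos' a)"
    by (rule square_integrable_series[OF abs_wcos'_le continuous_on_wcos(2)])
  ultimately show "?v \<in> H0 \<and> (\<forall>t. ?v (- t) = ?v t)"
    using wcos_series_weak_deriv[of a] unfolding H0_def by (auto simp: series_wcos_minus)
qed

lemma weak_deriv_cos_series: "weak_deriv (cos_series_H0 a) = abs_L2 (series wcos' a)"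
  by (rule weak_deriv_eqI)
    (use wcos_series_weak_deriv[of a] square_integrable_series[OF abs_wcos'_le continuous_on_wcos(2)]
      in \<open>simp_all add: cos_series_H0.rep_eq\<close>)

lemma L2_of_eq: "L2_of v = abs_L2 (fun_of v)"
  by (simp add: L2_of_def)

lemma L2_of_cos_series: "L2_of (cos_series_H0 a) = abs_L2 (series wcos a)"
proof -
  have "abs_L2 (fun_of (cos_series_H0 a)) = abs_L2 (series wcos a)"
    using fun_of[of "cos_series_H0 a"]
    by (intro abs_L2_eqI H0_square_integrable square_integrable_series[OF abs_wcos_le continuous_on_wcos(1)] AE_I2)
      (auto simp: cos_series_H0.rep_eq)
  then show ?thesis by (simp add: L2_of_eq)
qed

lemma abs_cos_series_le: "\<bar>fun_of (cos_series_H0 a) t\<bar> \<le> norm a"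
  using abs_series_le[OF abs_wcos_le] by (simp add: cos_series_H0.rep_eq)

text \<open>A sup bound on \<open>v\<close> and \<open>v'\<close> controls the \<open>W\<^sup>1\<^sup>,\<^sup>2\<close> norm because the interval has finite length;
  each of the two parts contributes \<open>2 \<pi>\<close> to the square of the constant.\<close>

lemma bounded_linear_cos_series: "bounded_linear cos_series_H0"
proof (rule bounded_linear_intro[where K = "sqrt (4 * pi)"])
  fix a b :: ell1 and x :: real
  show "cos_series_H0 (a + b) = cos_series_H0 a + cos_series_H0 b"
    by transfer (auto simp: series_linear)
  show "cos_series_H0 (x *\<^sub>R a) = x *\<^sub>R cos_series_H0 a"
    by transfer (auto simp: series_linear)
  have "norm (L2_of (cos_series_H0 a)) \<le> sqrt (2 * pi) * norm a"
    unfolding L2_of_cos_series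
    by (intro norm_abs_L2_le square_integrable_series abs_wcos_le continuous_on_wcos abs_series_le)
  moreover have "norm (weak_deriv (cos_series_H0 a)) \<le> sqrt (2 * pi) * norm a"
    unfolding weak_deriv_cos_series
    by (intro norm_abs_L2_le square_integrable_series abs_wcos'_le continuous_on_wcos abs_series_le)
  ultimately have "(norm (L2_of (cos_series_H0 a)))\<^sup>2 + (norm (weak_deriv (cos_series_H0 a)))\<^sup>2
      \<le> (sqrt (2 * pi) * norm a)\<^sup>2 + (sqrt (2 * pi) * norm a)\<^sup>2"
    by (intro add_mono power_mono) auto
  also have "\<dots> = (norm a * sqrt (4 * pi))\<^sup>2"
    by (simp add: power_mult_distrib)
  finally show "norm (cos_series_H0 a) \<le> norm a * sqrt (4 * pi)"
    unfolding norm_even_H0_def inner_even_H0_def power2_norm_eq_inner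
    by (intro real_le_lsqrt) auto
qed

lemma cos_series_unit: "cos_series_H0 (unit_ell1 k) = (1 / (1 + real k)) *\<^sub>R cos_even_H0 k"
  by transfer (simp add: fun_eq_iff series_unit[OF abs_wcos_le] wcos_def)

lemma cos_L2_eq: "cos_L2 k = abs_L2 (\<lambda>t. cos (real k * t))"
  and sin_L2_eq: "sin_L2 k = abs_L2 (\<lambda>t. sin (real k * t))"
  by (simp_all add: cos_L2_def sin_L2_def)

text \<open>Residuals of the equation carry no weight: they are expanded in the plain cosines.\<close>

definition cos_series_L2 :: "ell1 \<Rightarrow> L2" where
  "cos_series_L2 b = abs_L2 (series (\<lambda>k t. cos (real k * t)) b)"

lemma bounded_linear_cos_series_L2: "bounded_linear cos_series_L2"
  unfolding cos_series_L2_def[abs_def]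
  by (rule bounded_linear_abs_L2_series) (auto intro!: continuous_intros)

lemma cos_series_L2_unit: "cos_series_L2 (unit_ell1 k) = cos_L2 k"
proof -
  have "series (\<lambda>k t. cos (real k * t)) (unit_ell1 k) = (\<lambda>t. cos (real k * t))"
    by (rule ext, rule series_unit) simp
  then show ?thesis by (simp add: cos_series_L2_def cos_L2_eq)
qed

lemma weak_deriv_cos: "weak_deriv (cos_even_H0 k) = - real k *\<^sub>R sin_L2 k"
proof -
  have "(1 / (1 + real k)) *\<^sub>R weak_deriv (cos_even_H0 k) = abs_L2 (series wcos' (unit_ell1 k))"
    by (simp add: weak_deriv_cos_series flip: weak_deriv_scaleR cos_series_unit)
  also have "series wcos' (unit_ell1 k) = (\<lambda>t. - real k / (1 + real k) * sin (real k * t))"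
    by (simp add: fun_eq_iff series_unit[OF abs_wcos'_le] wcos'_def)
  also have "abs_L2 \<dots> = (- real k / (1 + real k)) *\<^sub>R sin_L2 k"
    by (subst sin_L2_eq, subst scaleR_L2.abs_eq)
      (simp_all add: L2_rel_def square_integrable_continuous continuous_intros)
  finally have "(1 + real k) *\<^sub>R (1 / (1 + real k)) *\<^sub>R weak_deriv (cos_even_H0 k)
      = (1 + real k) *\<^sub>R (- real k / (1 + real k)) *\<^sub>R sin_L2 k" by simp
  then show ?thesis by simp
qed

lemma L2_of_cos: "L2_of (cos_even_H0 k) = cos_L2 k"
  unfolding L2_of_eq cos_L2_eq
proof (rule abs_L2_eqI)
  show "square_integrable (fun_of (cos_even_H0 k))"
    using fun_of[of "cos_even_H0 k"] by (simp add: H0_square_integrable)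
qed (auto simp: cos_even_H0.rep_eq intro!: AE_I2 square_integrable_continuous continuous_intros)

section \<open>The symbol of the linearised operator\<close>

text \<open>The eigenvalue of \<open>v \<mapsto> B v'\<close> on \<open>cos (k t)\<close>. At \<open>k = 0\<close> the quotient is a division by zero,
  but the factor \<open>k\<close> gives the correct value 0 for constants.\<close>

definition symbol :: "real \<Rightarrow> nat \<Rightarrow> real" where
  "symbol r k = real k * ((1 + r ^ (2 * k)) / (1 - r ^ (2 * k)))"

lemma symbol_0 [simp]: "symbol r 0 = 0"
  by (simp add: symbol_def)

lemma bif_point_eq: "bif_point r n = 1 / symbol r n"
  by (simp add: bif_point_def symbol_def)

lemma symbol_ge:
  assumes "0 < r" "r < 1"
  shows "real k \<le> symbol r k"
proof (cases "k = 0")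
  case False
  then have "r ^ (2 * k) < 1" using assms by (intro power_less_one_iff[THEN iffD2]) auto
  then have "1 \<le> (1 + r ^ (2 * k)) / (1 - r ^ (2 * k))" using assms by (simp add: le_divide_eq)
  from mult_left_mono[OF this, of "real k"] show ?thesis by (simp add: symbol_def)
qed simp

lemma symbol_nonneg: "0 < r \<Longrightarrow> r < 1 \<Longrightarrow> 0 \<le> symbol r k"
  using symbol_ge[of r k] by linarith

lemma symbol_le:
  assumes "0 < r" "r < 1"
  shows "symbol r k \<le> 2 / (1 - r\<^sup>2) * real k"
proof (cases "k = 0")
  case False
  then have "r ^ (2 * k) \<le> r\<^sup>2" using assms by (intro power_decreasing) auto
  moreover have "r\<^sup>2 < 1" using assms by (simp add: power_less_one_iff)
  ultimately have "(1 + r ^ (2 * k)) / (1 - r ^ (2 * k)) \<le> 2 / (1 - r\<^sup>2)"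
    by (intro frac_le) auto
  then have "real k * ((1 + r ^ (2 * k)) / (1 - r ^ (2 * k))) \<le> real k * (2 / (1 - r\<^sup>2))"
    by (intro mult_left_mono) auto
  then show ?thesis by (simp add: symbol_def mult.commute)
qed simp

text \<open>Divided by \<open>1 - q\<close>, this says that the sum of the \<open>2k + 3\<close> powers \<open>1, q, \<dots>, q\<^sup>2\<^sup>k\<^sup>+\<^sup>2\<close> exceeds
  \<open>2k + 3\<close> times the middle one, as in the inequality of arithmetic and geometric means. The
  increment of the difference from \<open>k\<close> to \<open>k + 1\<close> is nonnegative by Bernoulli's inequality.\<close>

lemma geometric_mean_gap:
  fixes q :: real
  assumes q: "0 < q" "q < 1"
  shows "(2 * real k + 3) * (q ^ Suc k * (1 - q)) < 1 - q ^ (2 * k + 3)"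
proof (induction k)
  case 0
  have "1 - q ^ 3 - 3 * (q * (1 - q)) = (1 - q) ^ 3"
    by (simp add: power3_eq_cube algebra_simps)
  moreover have "(1 - q) ^ 3 > 0" using q by simp
  ultimately have "3 * (q * (1 - q)) < 1 - q ^ 3" by linarith
  then show ?case by simp
next
  case (Suc k)
  have shift: "1 + (q - 1) = q" by simp
  have "1 + real (k + 2) * (q - 1) \<le> q ^ (k + 2)" "1 + real (k + 3) * (q - 1) \<le> q ^ (k + 3)"
    using Bernoulli_inequality[of "q - 1" "k + 2"] Bernoulli_inequality[of "q - 1" "k + 3"] q
    by (simp_all only: shift)
  then have "0 \<le> q ^ (k + 2) + q ^ (k + 3) - (2 * real k + 5) * q + (2 * real k + 3)"
    by (simp add: algebra_simps)
  then have "0 \<le> (q ^ Suc k * (1 - q)) * (q ^ (k + 2) + q ^ (k + 3) - (2 * real k + 5) * q + (2 * real k + 3))"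
    using q by (intro mult_nonneg_nonneg) auto
  also have "\<dots> = (q ^ (2 * k + 3) - q ^ (2 * k + 5))
      - (2 * real k + 5) * (q ^ Suc (Suc k) * (1 - q)) + (2 * real k + 3) * (q ^ Suc k * (1 - q))"
  proof -
    define x where "x = q ^ k"
    have "q ^ Suc k = x * q" "q ^ Suc (Suc k) = x * q\<^sup>2"
      by (simp_all add: x_def power2_eq_square)
    moreover have "q ^ (k + 2) = x * q\<^sup>2" "q ^ (k + 3) = x * q ^ 3"
      "q ^ (2 * k + 3) = x\<^sup>2 * q ^ 3" "q ^ (2 * k + 5) = x\<^sup>2 * q ^ 5"
      by (simp_all only: x_def power_add power_even_eq)
    ultimately show ?thesis by (simp only:) (simp add: algebra_simps eval_nat_numeral)
  qed
  finally have "(2 * real k + 5) * (q ^ Suc (Suc k) * (1 - q)) < 1 - q ^ (2 * k + 5)"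
    using Suc.IH by linarith
  moreover have "2 * Suc k + 3 = 2 * k + 5" "2 * real (Suc k) + 3 = 2 * real k + 5" by simp_all
  ultimately show ?case by (simp only:)
qed

text \<open>With \<open>q = r\<^sup>2\<close> and denominators cleared, the claim for \<open>k \<ge> 1\<close> is
  \<open>(2k + 1) q\<^sup>k (1 - q) < 1 - q\<^sup>2\<^sup>k\<^sup>+\<^sup>1\<close>. Monotonicity is what makes the kernel of the linearised
  operator one-dimensional.\<close>

lemma symbol_less_Suc:
  assumes r: "0 < r" "r < 1"
  shows "symbol r k < symbol r (Suc k)"
proof (cases k)
  case 0
  then show ?thesis using symbol_ge[OF r, of 1] by simp
next
  case (Suc m)
  define q where "q = r\<^sup>2"
  have q: "0 < q" "q < 1" using r by (simp_all add: q_def power_less_one_iff)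
  define x where "x = q ^ k"
  have x: "0 < x" "x < 1" using q power_Suc_less_one[of q m] by (simp_all add: x_def Suc)
  have qx: "q * x < 1" using mult_strict_mono[of q 1 x 1] q x by simp
  have "(2 * real k + 1) * (x * (1 - q)) < 1 - q * (x * x)"
  proof -
    have "q ^ (2 * m + 3) = q * (x * x)"
      unfolding power_add power_even_eq by (simp add: x_def Suc power2_eq_square power3_eq_cube)
    moreover have "2 * real m + 3 = 2 * real k + 1" "q ^ Suc m = x" by (simp_all add: Suc x_def)
    ultimately show ?thesis using geometric_mean_gap[OF q, of m] by (simp only:)
  qed
  then have "real k * ((1 + x) * (1 - q * x)) < real (Suc k) * ((1 + q * x) * (1 - x))"
    by (simp add: algebra_simps)
  then have "real k * ((1 + x) / (1 - x)) < real (Suc k) * ((1 + q * x) / (1 - q * x))"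
    using x qx by (simp add: divide_less_eq less_divide_eq field_simps)
  moreover have "r ^ (2 * k) = x" "r ^ (2 * Suc k) = q * x"
    by (simp_all only: power_mult q_def x_def power_Suc)
  ultimately show ?thesis by (simp only: symbol_def)
qed

lemma symbol_inj: "0 < r \<Longrightarrow> r < 1 \<Longrightarrow> symbol r k = symbol r n \<longleftrightarrow> k = n"
  using strict_mono_Suc_iff[of "symbol r"] symbol_less_Suc strict_mono_eq by blast

section \<open>The quadratic form of the equation on cosine series\<close>

lemma fun_of_bounded: obtains M where "0 \<le> M" "\<And>t. \<bar>fun_of v t\<bar> \<le> M"
proof -
  have v: "fun_of v \<in> H0" using fun_of[of v] by simp
  then have "compact (fun_of v ` {-pi..pi})"
    by (intro compact_continuous_image H0_continuous) simp_all
  then obtain M where M: "\<And>t. t \<in> {-pi..pi} \<Longrightarrow> \<bar>fun_of v t\<bar> \<le> M"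
    using compact_imp_bounded bounded_iff by (metis imageI real_norm_def)
  have M0: "0 \<le> M" using M[of 0] by (simp add: order_trans[OF abs_ge_zero])
  have "\<bar>fun_of v t\<bar> \<le> M" for t
    using M[of t] M0 v by (cases "t \<in> {-pi..pi}") (auto simp: H0_def)
  with M0 show thesis by (rule that)
qed

lemma square_integrable_fun_of_mult:
  assumes "square_integrable f"
  shows "square_integrable (\<lambda>t. fun_of v t * f t)"
proof -
  obtain M where M: "\<And>t. \<bar>fun_of v t\<bar> \<le> M" using fun_of_bounded[of v] by blast
  have "fun_of v \<in> borel_measurable leb_pi"
    using fun_of[of v] H0_square_integrable unfolding square_integrable_def by simp
  from square_integrable_bounded_mult[OF this M assms] show ?thesis .
qed

lemma mult_L2_abs:
  assumes "square_integrable f"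
  shows "mult_L2 v (abs_L2 f) = abs_L2 (\<lambda>t. fun_of v t * f t)"
proof -
  have "mult_L2 v (abs_L2 f) = abs_L2 (\<lambda>t. fun_of v t * rep_L2 (abs_L2 f) t)"
    by (simp add: mult_L2_def)
  also have "\<dots> = abs_L2 (\<lambda>t. fun_of v t * f t)"
    using rep_abs_L2[OF assms] AE_eq_binop[where h = "(*)" and f = "fun_of v" and f' = "fun_of v"]
    by (intro abs_L2_eqI square_integrable_fun_of_mult assms rep_L2_square_integrable) auto
  finally show ?thesis .
qed

lemma abs_rep_L2: "abs_L2 (rep_L2 w) = w"
  by (rule Quotient_abs_rep[OF Quotient_L2])

lemma abs_L2_add:
  "square_integrable f \<Longrightarrow> square_integrable g \<Longrightarrow> abs_L2 (\<lambda>t. f t + g t) = abs_L2 f + abs_L2 g"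
  by (simp add: plus_L2.abs_eq L2_rel_def)

lemma abs_L2_scale: "square_integrable f \<Longrightarrow> abs_L2 (\<lambda>t. x * f t) = x *\<^sub>R abs_L2 f"
  by (simp add: scaleR_L2.abs_eq L2_rel_def)

lemma mult_L2_linear:
  "mult_L2 (u + v) w = mult_L2 u w + mult_L2 v w" "mult_L2 (x *\<^sub>R v) w = x *\<^sub>R mult_L2 v w"
  "mult_L2 v (w + w') = mult_L2 v w + mult_L2 v w'" "mult_L2 v (x *\<^sub>R w) = x *\<^sub>R mult_L2 v w"
proof -
  define f g where "f = rep_L2 w" and "g = rep_L2 w'"
  have fg: "square_integrable f" "square_integrable g"
    by (simp_all add: f_def g_def rep_L2_square_integrable)
  have w: "w = abs_L2 f" "w' = abs_L2 g" by (simp_all add: f_def g_def abs_rep_L2)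
  note rules = mult_L2_abs fg square_integrable_fun_of_mult plus_even_H0.rep_eq scaleR_even_H0.rep_eq
    square_integrable_add square_integrable_scale
    mult.left_commute[of _ x] mult.assoc distrib_left distrib_right
  show "mult_L2 (u + v) w = mult_L2 u w + mult_L2 v w" "mult_L2 (x *\<^sub>R v) w = x *\<^sub>R mult_L2 v w"
    "mult_L2 v (w + w') = mult_L2 v w + mult_L2 v w'" "mult_L2 v (x *\<^sub>R w) = x *\<^sub>R mult_L2 v w"
    unfolding w by (simp_all add: rules flip: abs_L2_add abs_L2_scale)
qed

lemma norm_mult_L2_le:
  assumes "0 \<le> M" and M: "\<And>t. \<bar>fun_of v t\<bar> \<le> M"
  shows "norm (mult_L2 v w) \<le> M * norm w"
proof -
  define f where "f = rep_L2 w"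
  have f: "square_integrable f" "w = abs_L2 f"
    by (simp_all add: f_def rep_L2_square_integrable abs_rep_L2)
  have "(LINT t|leb_pi. (fun_of v t * f t)\<^sup>2) \<le> (LINT t|leb_pi. M\<^sup>2 * (f t)\<^sup>2)"
  proof (intro integral_mono)
    show "integrable leb_pi (\<lambda>t. (fun_of v t * f t)\<^sup>2)" "integrable leb_pi (\<lambda>t. M\<^sup>2 * (f t)\<^sup>2)"
      using square_integrable_fun_of_mult[OF f(1)] f(1) unfolding square_integrable_def by auto
    fix t
    have "(fun_of v t)\<^sup>2 \<le> M\<^sup>2" using M[of t] by (metis abs_ge_zero power2_abs power_mono)
    then show "(fun_of v t * f t)\<^sup>2 \<le> M\<^sup>2 * (f t)\<^sup>2"
      by (simp add: power_mult_distrib mult_right_mono)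
  qed
  also have "\<dots> = M\<^sup>2 * (LINT t|leb_pi. (f t)\<^sup>2)" by simp
  finally have "sqrt (LINT t|leb_pi. (fun_of v t * f t)\<^sup>2) \<le> sqrt (M\<^sup>2 * (LINT t|leb_pi. (f t)\<^sup>2))"
    by simp
  then show ?thesis
    using assms(1) square_integrable_fun_of_mult[OF f(1)]
    by (simp add: f mult_L2_abs norm_L2_eq real_sqrt_mult)
qed

text \<open>The polarised quadratic part of the equation. On the diagonal it is twice
  \<open>v B(v') + B(v v')\<close>; symmetry makes the argument of the last \<open>B\<close> the derivative \<open>(u v)'\<close>, whose
  expansion for two cosines needs no distinction of signs.\<close>

definition babenko_form :: "(L2 \<Rightarrow> L2) \<Rightarrow> even_H0 \<Rightarrow> even_H0 \<Rightarrow> L2" where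
  "babenko_form B u v = mult_L2 u (B (weak_deriv v)) + mult_L2 v (B (weak_deriv u))
     + B (mult_L2 u (weak_deriv v) + mult_L2 v (weak_deriv u))"

lemma babenko_form_commute: "babenko_form B u v = babenko_form B v u"
  by (simp add: babenko_form_def add.commute)

text \<open>Multiplication by \<open>cos_series_H0 a\<close> is bounded by \<open>\<parallel>a\<parallel>\<close> through the sup norm; the fixed \<open>v\<close> is bounded because it is continuous on a compact interval.\<close>

lemma bounded_linear_babenko_form_cos_series:
  assumes B: "bounded_linear B"
  shows "bounded_linear (\<lambda>a. babenko_form B (cos_series_H0 a) v)"
proof -
  obtain M where M: "0 \<le> M" "\<And>t. \<bar>fun_of v t\<bar> \<le> M" using fun_of_bounded[of v] by blast
  have right: "bounded_linear (mult_L2 v)"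
    by (rule bounded_linear_intro[where K = M])
      (use norm_mult_L2_le[OF M] in \<open>simp_all add: mult_L2_linear mult.commute\<close>)
  have left: "bounded_linear (\<lambda>a. mult_L2 (cos_series_H0 a) w)" for w
    by (rule bounded_linear_intro[where K = "norm w"])
      (use norm_mult_L2_le[OF norm_ge_zero abs_cos_series_le]
        in \<open>simp_all add: mult_L2_linear bounded_linear.linear[OF bounded_linear_cos_series] linear_add linear_scale\<close>)
  have D: "bounded_linear (\<lambda>a. weak_deriv (cos_series_H0 a))"
    unfolding weak_deriv_cos_series by (rule bounded_linear_abs_L2_series[OF abs_wcos'_le continuous_on_wcos(2)])
  show ?thesis
    unfolding babenko_form_def
    by (intro bounded_linear_add left bounded_linear_compose[OF right]
        bounded_linear_compose[OF B] D)
qed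

definition freq_diff :: "nat \<Rightarrow> nat \<Rightarrow> nat" where
  "freq_diff i j = nat \<bar>int i - int j\<bar>"

lemma freq_diff_le: "freq_diff i j \<le> i + j"
  by (simp add: freq_diff_def nat_le_iff)

lemma real_freq_diff: "real (freq_diff i j) = \<bar>real i - real j\<bar>"
  by (simp add: freq_diff_def)

lemma cos_freq_diff: "cos (real (freq_diff i j) * t) = cos ((real i - real j) * t)"
proof -
  have "cos (\<bar>x\<bar> * t) = cos (x * t)" for x :: real by (simp add: abs_if)
  then show ?thesis by (simp add: real_freq_diff)
qed

lemma sin_freq_diff:
  "real (freq_diff i j) * sin (real (freq_diff i j) * t) = (real i - real j) * sin ((real i - real j) * t)"
proof -
  have "\<bar>x\<bar> * sin (\<bar>x\<bar> * t) = x * sin (x * t)" for x :: real by (simp add: abs_if)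
  then show ?thesis by (simp add: real_freq_diff)
qed

lemma cos_times_cos_L2:
  "mult_L2 (cos_even_H0 i) (cos_L2 j) = (1 / 2) *\<^sub>R (cos_L2 (i + j) + cos_L2 (freq_diff i j))"
proof -
  have c: "square_integrable (\<lambda>t. cos (real k * t))" for k
    by (intro square_integrable_continuous continuous_intros)
  have "mult_L2 (cos_even_H0 i) (cos_L2 j) = abs_L2 (\<lambda>t. fun_of (cos_even_H0 i) t * cos (real j * t))"
    by (simp add: cos_L2_eq mult_L2_abs c)
  also have "\<dots> = abs_L2 (\<lambda>t. (1 / 2) * (cos (real (i + j) * t) + cos (real (freq_diff i j) * t)))"
  proof (intro abs_L2_eqI AE_I2 square_integrable_fun_of_mult square_integrable_scale square_integrable_add c)
    fix t assume "t \<in> space leb_pi"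
    then show "fun_of (cos_even_H0 i) t * cos (real j * t)
        = (1 / 2) * (cos (real (i + j) * t) + cos (real (freq_diff i j) * t))"
      unfolding cos_freq_diff by (simp add: cos_even_H0.rep_eq cos_add cos_diff algebra_simps)
  qed
  also have "\<dots> = (1 / 2) *\<^sub>R (cos_L2 (i + j) + cos_L2 (freq_diff i j))"
    by (simp only: cos_L2_eq abs_L2_add[OF c c] abs_L2_scale[OF square_integrable_add[OF c c]])
  finally show ?thesis .
qed

text \<open>The left-hand side is the derivative of \<open>cos (i t) cos (j t)\<close>, that is, of
  \<open>(cos ((i + j) t) + cos ((i - j) t)) / 2\<close>.\<close>

lemma weak_deriv_product_cos:
  "mult_L2 (cos_even_H0 i) (weak_deriv (cos_even_H0 j)) + mult_L2 (cos_even_H0 j) (weak_deriv (cos_even_H0 i))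
    = (- 1 / 2) *\<^sub>R (real (i + j) *\<^sub>R sin_L2 (i + j) + real (freq_diff i j) *\<^sub>R sin_L2 (freq_diff i j))"
proof -
  have s0: "square_integrable (\<lambda>t. sin (real k * t))" for k
    by (intro square_integrable_continuous continuous_intros)
  note s = square_integrable_scale[OF s0]
  have sin: "x *\<^sub>R sin_L2 k = abs_L2 (\<lambda>t. x * sin (real k * t))" for x k
    by (simp add: sin_L2_eq abs_L2_scale s0)
  have "mult_L2 (cos_even_H0 i) (weak_deriv (cos_even_H0 j)) + mult_L2 (cos_even_H0 j) (weak_deriv (cos_even_H0 i))
      = abs_L2 (\<lambda>t. fun_of (cos_even_H0 i) t * (- real j * sin (real j * t))
          + fun_of (cos_even_H0 j) t * (- real i * sin (real i * t)))"
    unfolding weak_deriv_cos sin mult_L2_abs[OF s]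
    by (rule abs_L2_add[symmetric]) (intro square_integrable_fun_of_mult s)+
  also have "\<dots> = abs_L2 (\<lambda>t. (- 1 / 2) * (real (i + j) * sin (real (i + j) * t)
      + real (freq_diff i j) * sin (real (freq_diff i j) * t)))"
  proof (intro abs_L2_eqI AE_I2 square_integrable_add square_integrable_fun_of_mult square_integrable_scale s0)
    fix t assume "t \<in> space leb_pi"
    then have "fun_of (cos_even_H0 k) t = cos (real k * t)" for k by (simp add: cos_even_H0.rep_eq)
    then show "fun_of (cos_even_H0 i) t * (- real j * sin (real j * t))
          + fun_of (cos_even_H0 j) t * (- real i * sin (real i * t))
        = (- 1 / 2) * (real (i + j) * sin (real (i + j) * t) + real (freq_diff i j) * sin (real (freq_diff i j) * t))"
      unfolding sin_freq_diff by (simp add: sin_add sin_diff algebra_simps)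
  qed
  also have "\<dots> = (- 1 / 2) *\<^sub>R (real (i + j) *\<^sub>R sin_L2 (i + j) + real (freq_diff i j) *\<^sub>R sin_L2 (freq_diff i j))"
    unfolding sin by (simp only: abs_L2_add[OF s s] abs_L2_scale[OF square_integrable_add[OF s s]])
  finally show ?thesis .
qed

locale babenko =
  fixes r :: real and B :: "L2 \<Rightarrow> L2"
  assumes r: "0 < r" "r < 1" and B: "is_babenko_op r B"
begin

lemma bounded_linear_B: "bounded_linear B"
  using B by (simp add: is_babenko_op_def)

lemmas linear_B = bounded_linear.linear[OF bounded_linear_B]

lemma B_sin: "real k *\<^sub>R B (sin_L2 k) = - symbol r k *\<^sub>R cos_L2 k"
proof (cases "k = 0")
  case False
  then have "B (sin_L2 k) = - ((1 + r ^ (2 * k)) / (1 - r ^ (2 * k))) *\<^sub>R cos_L2 k"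
    using B by (simp add: is_babenko_op_def)
  then show ?thesis by (simp add: symbol_def)
qed simp

lemma B_weak_deriv_cos: "B (weak_deriv (cos_even_H0 k)) = symbol r k *\<^sub>R cos_L2 k"
  using B_sin[of k] by (simp add: weak_deriv_cos linear_scale[OF linear_B] linear_neg[OF linear_B])

text \<open>The coefficients of \<open>babenko_form B\<close> on a pair of weighted cosines. The two weights outweigh the
  linear growth of the symbol, so these sequences are uniformly bounded in \<open>\<ell>\<^sup>1\<close>.\<close>

definition quad_coeff :: "nat \<Rightarrow> nat \<Rightarrow> ell1" where
  "quad_coeff i j = (1 / (2 * ((1 + real i) * (1 + real j)))) *\<^sub>R
     ((symbol r i + symbol r j + symbol r (i + j)) *\<^sub>R unit_ell1 (i + j)
      + (symbol r i + symbol r j + symbol r (freq_diff i j)) *\<^sub>R unit_ell1 (freq_diff i j))"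

definition quad :: "ell1 \<Rightarrow>\<^sub>L ell1 \<Rightarrow>\<^sub>L ell1" where
  "quad = lin_ext (\<lambda>i. lin_ext (quad_coeff i))"

definition symbol_op :: "ell1 \<Rightarrow>\<^sub>L ell1" where
  "symbol_op = lin_ext (\<lambda>k. (symbol r k / (1 + real k)) *\<^sub>R unit_ell1 k)"

definition incl_op :: "ell1 \<Rightarrow>\<^sub>L ell1" where
  "incl_op = lin_ext (\<lambda>k. (1 / (1 + real k)) *\<^sub>R unit_ell1 k)"

lemma norm_quad_coeff_le: "norm (quad_coeff i j) \<le> 4 / (1 - r\<^sup>2)"
proof -
  define C where "C = 2 / (1 - r\<^sup>2)"
  have C: "0 \<le> C" using r by (simp add: C_def power_le_one)
  have s: "0 \<le> symbol r k" "symbol r k \<le> C * real k" for k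
    using symbol_nonneg[OF r] symbol_le[OF r] by (simp_all add: C_def)
  have t: "\<bar>symbol r i + symbol r j + symbol r k\<bar> \<le> 2 * C * (real i + real j)" if "k \<le> i + j" for k
  proof -
    have "C * real k \<le> C * (real i + real j)" using that C by (intro mult_left_mono) auto
    then show ?thesis using s[of i] s[of j] s[of k] by (simp add: algebra_simps)
  qed
  have halve: "1 / (2 * d) * (2 * C * n + 2 * C * n) = 2 * C * (n / d)" for d n :: real
    by (simp add: divide_simps)
  have "norm (quad_coeff i j) \<le> 1 / (2 * ((1 + real i) * (1 + real j))) *
      (2 * C * (real i + real j) + 2 * C * (real i + real j))"
    unfolding quad_coeff_def norm_scaleR
    by (intro mult_mono order_trans[OF norm_triangle_ineq] add_mono)
      (use t[of "i + j"] t[OF freq_diff_le] in auto)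
  also have "\<dots> = 2 * C * ((real i + real j) / ((1 + real i) * (1 + real j)))"
    using halve by blast
  also have "\<dots> \<le> 2 * C * 1"
    using C by (intro mult_left_mono) (auto simp: divide_le_eq algebra_simps)
  finally show ?thesis by (simp add: C_def)
qed

lemma quad_unit: "quad (unit_ell1 i) (unit_ell1 j) = quad_coeff i j"
proof -
  have "lin_ext (\<lambda>i. lin_ext (quad_coeff i)) (unit_ell1 i) = lin_ext (quad_coeff i)"
    by (rule lin_ext_unit[OF norm_lin_ext[OF norm_quad_coeff_le]])
  then show ?thesis
    by (simp add: quad_def lin_ext_unit[OF norm_quad_coeff_le])
qed

lemma symbol_op_unit: "symbol_op (unit_ell1 k) = (symbol r k / (1 + real k)) *\<^sub>R unit_ell1 k"
  unfolding symbol_op_def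
proof (rule lin_ext_unit)
  fix k
  have "symbol r k / (1 + real k) \<le> 2 / (1 - r\<^sup>2) * real k / (1 + real k)"
    using symbol_le[OF r] by (intro divide_right_mono) auto
  also have "\<dots> = 2 / (1 - r\<^sup>2) * (real k / (1 + real k))" by simp
  also have "\<dots> \<le> 2 / (1 - r\<^sup>2) * 1"
    using r by (intro mult_left_mono) (auto simp: power_le_one)
  finally show "norm ((symbol r k / (1 + real k)) *\<^sub>R unit_ell1 k) \<le> 2 / (1 - r\<^sup>2)"
    using symbol_nonneg[OF r] by simp
qed

lemma incl_op_unit: "incl_op (unit_ell1 k) = (1 / (1 + real k)) *\<^sub>R unit_ell1 k"
  unfolding incl_op_def by (rule lin_ext_unit[where C = 1]) simp

lemma linear_cos_series_L2: "linear cos_series_L2"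
  by (rule bounded_linear.linear[OF bounded_linear_cos_series_L2])

lemma bounded_linear_cos_series_L2_comp: "bounded_linear (\<lambda>a. cos_series_L2 (blinfun_apply f a))"
  by (rule bounded_linear_compose[OF bounded_linear_cos_series_L2 blinfun.bounded_linear_right])

lemma B_weak_deriv_cos_series: "B (weak_deriv (cos_series_H0 a)) = cos_series_L2 (symbol_op a)"
proof (rule bounded_linear_ell1_eqI[where a = a and f = "\<lambda>a. B (weak_deriv (cos_series_H0 a))"])
  show "bounded_linear (\<lambda>a. B (weak_deriv (cos_series_H0 a)))"
    unfolding weak_deriv_cos_series
    by (rule bounded_linear_compose[OF bounded_linear_B
          bounded_linear_abs_L2_series[OF abs_wcos'_le continuous_on_wcos(2)]])
  show "B (weak_deriv (cos_series_H0 (unit_ell1 k))) = cos_series_L2 (symbol_op (unit_ell1 k))" for k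
    by (simp add: cos_series_unit weak_deriv_scaleR linear_scale[OF linear_B] B_weak_deriv_cos
        symbol_op_unit linear_scale[OF linear_cos_series_L2] cos_series_L2_unit)
qed (rule bounded_linear_cos_series_L2_comp)

lemma L2_of_cos_series_incl: "L2_of (cos_series_H0 a) = cos_series_L2 (incl_op a)"
proof (rule bounded_linear_ell1_eqI[where a = a and f = "\<lambda>a. L2_of (cos_series_H0 a)"])
  show "bounded_linear (\<lambda>a. L2_of (cos_series_H0 a))"
    unfolding L2_of_cos_series
    by (rule bounded_linear_abs_L2_series[OF abs_wcos_le continuous_on_wcos(1)])
  show "L2_of (cos_series_H0 (unit_ell1 k)) = cos_series_L2 (incl_op (unit_ell1 k))" for k
    by (simp add: cos_series_unit L2_of_scaleR L2_of_cos incl_op_unit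
        linear_scale[OF linear_cos_series_L2] cos_series_L2_unit)
qed (rule bounded_linear_cos_series_L2_comp)

lemma babenko_form_cos:
  "babenko_form B (cos_even_H0 i) (cos_even_H0 j)
    = (1 / 2) *\<^sub>R ((symbol r i + symbol r j + symbol r (i + j)) *\<^sub>R cos_L2 (i + j)
      + (symbol r i + symbol r j + symbol r (freq_diff i j)) *\<^sub>R cos_L2 (freq_diff i j))"
proof -
  have "B ((- 1 / 2) *\<^sub>R (real (i + j) *\<^sub>R sin_L2 (i + j) + real (freq_diff i j) *\<^sub>R sin_L2 (freq_diff i j)))
      = (- 1 / 2) *\<^sub>R (real (i + j) *\<^sub>R B (sin_L2 (i + j)) + real (freq_diff i j) *\<^sub>R B (sin_L2 (freq_diff i j)))"
    by (simp only: linear_scale[OF linear_B] linear_add[OF linear_B])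
  also have "\<dots> = (1 / 2) *\<^sub>R (symbol r (i + j) *\<^sub>R cos_L2 (i + j) + symbol r (freq_diff i j) *\<^sub>R cos_L2 (freq_diff i j))"
    unfolding B_sin by (simp add: algebra_simps)
  finally have 1: "B (mult_L2 (cos_even_H0 i) (weak_deriv (cos_even_H0 j))
        + mult_L2 (cos_even_H0 j) (weak_deriv (cos_even_H0 i)))
      = (1 / 2) *\<^sub>R (symbol r (i + j) *\<^sub>R cos_L2 (i + j) + symbol r (freq_diff i j) *\<^sub>R cos_L2 (freq_diff i j))"
    unfolding weak_deriv_product_cos .
  have 2: "freq_diff j i = freq_diff i j" by (simp add: freq_diff_def abs_minus_commute)
  show ?thesis
    unfolding babenko_form_def 1 B_weak_deriv_cos mult_L2_linear cos_times_cos_L2 2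
    by (simp add: algebra_simps add.commute[of j i])
qed

lemma babenko_form_cos_series:
  "babenko_form B (cos_series_H0 a) (cos_series_H0 b) = cos_series_L2 (quad a b)"
proof -
  note form_bl = bounded_linear_babenko_form_cos_series[OF bounded_linear_B]
  have form_scale: "babenko_form B (x *\<^sub>R u) (y *\<^sub>R v) = (x * y) *\<^sub>R babenko_form B u v" for x y u v
    by (simp add: babenko_form_def mult_L2_linear weak_deriv_scaleR linear_scale[OF linear_B]
        linear_add[OF linear_B] algebra_simps)
  have unit: "babenko_form B (cos_series_H0 (unit_ell1 i)) (cos_series_H0 (unit_ell1 j))
      = cos_series_L2 (quad (unit_ell1 i) (unit_ell1 j))" for i j
    unfolding cos_series_unit form_scale babenko_form_cos quad_unit quad_coeff_def
    by (simp add: linear_scale[OF linear_cos_series_L2] linear_add[OF linear_cos_series_L2] cos_series_L2_unit)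
  have "bounded_linear (\<lambda>b. babenko_form B (cos_series_H0 (unit_ell1 i)) (cos_series_H0 b))" for i
    by (subst babenko_form_commute) (rule form_bl)
  then have semi_unit:
    "babenko_form B (cos_series_H0 (unit_ell1 i)) (cos_series_H0 b) = cos_series_L2 (quad (unit_ell1 i) b)" for i
    by (rule bounded_linear_ell1_eqI[OF _ bounded_linear_cos_series_L2_comp unit])
  have "bounded_linear (\<lambda>a. quad a b)"
    by (rule bounded_linear_compose[OF blinfun.bounded_linear_left blinfun.bounded_linear_right])
  then show ?thesis
    by (intro bounded_linear_ell1_eqI[OF form_bl _ semi_unit]
        bounded_linear_compose[OF bounded_linear_cos_series_L2])
qed

text \<open>This transfers the equation to coefficient space: it suffices to make the argument of
  \<open>cos_series_L2\<close> vanish.\<close>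

lemma babenko_F_cos_series:
  "babenko_F B (\<mu>, cos_series_H0 a)
    = cos_series_L2 (\<mu> *\<^sub>R symbol_op a - incl_op a - (1 / 2) *\<^sub>R quad a a)"
proof -
  define v where "v = cos_series_H0 a"
  have "(1 / 2) *\<^sub>R babenko_form B v v = mult_L2 v (B (weak_deriv v)) + B (mult_L2 v (weak_deriv v))"
    by (simp add: babenko_form_def linear_scale[OF linear_B] scaleR_right_distrib flip: scaleR_2)
  then have "babenko_F B (\<mu>, v) = \<mu> *\<^sub>R B (weak_deriv v) - L2_of v - (1 / 2) *\<^sub>R babenko_form B v v"
    by (simp add: babenko_F_def)
  then show ?thesis
    unfolding v_def babenko_form_cos_series B_weak_deriv_cos_series L2_of_cos_series_incl
    by (simp only: linear_diff[OF linear_cos_series_L2] linear_scale[OF linear_cos_series_L2])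
qed

end

section \<open>Bifurcation\<close>

context babenko
begin

lemma quad_commute: "quad a b = quad b a"
proof -
  have unit: "quad (unit_ell1 i) (unit_ell1 j) = quad (unit_ell1 j) (unit_ell1 i)" for i j
    by (simp add: quad_unit quad_coeff_def freq_diff_def abs_minus_commute add.commute mult.commute)
  have left: "bounded_linear (\<lambda>a. quad a b)" for b
    by (rule bounded_linear_compose[OF blinfun.bounded_linear_left blinfun.bounded_linear_right])
  have "quad (unit_ell1 i) b = quad b (unit_ell1 i)" for i
    by (rule bounded_linear_ell1_eqI[OF blinfun.bounded_linear_right left unit])
  then show ?thesis
    by (rule bounded_linear_ell1_eqI[OF left blinfun.bounded_linear_right])
qed

lemma bif_point_pos: "1 \<le> n \<Longrightarrow> 0 < bif_point r n"
  using symbol_ge[OF r, of n] by (simp add: bif_point_eq)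

text \<open>Since the symbol is at least \<open>k\<close>, the denominator grows linearly and the quotient is at most
  \<open>2 / \<mu>\<close> as soon as \<open>k \<ge> 2 / \<mu> + 1\<close>; the sum over the finitely many smaller \<open>k\<close> covers the rest.
  At \<open>k = n\<close> the denominator is 0 and so is the quotient.\<close>

lemma resolvent_bounded:
  assumes n: "1 \<le> n"
  obtains C where "\<And>k. \<bar>(1 + real k) / (bif_point r n * symbol r k - 1)\<bar> \<le> C"
proof -
  define \<mu> where "\<mu> = bif_point r n"
  have \<mu>: "\<mu> > 0" using bif_point_pos[OF n] by (simp add: \<mu>_def)
  define g where "g k = \<bar>(1 + real k) / (\<mu> * symbol r k - 1)\<bar>" for k
  define K where "K = nat \<lceil>2 / \<mu>\<rceil> + 1"
  have "g k \<le> 2 / \<mu> + (\<Sum>k<K. g k)" for k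
  proof (cases "k < K")
    case True
    then have "g k \<le> (\<Sum>k<K. g k)" by (intro member_le_sum) (auto simp: g_def)
    then show ?thesis using \<mu> by (simp add: add_increasing)
  next
    case False
    then have "real k \<ge> 2 / \<mu> + 1" unfolding K_def by linarith
    then have "\<mu> * real k \<ge> \<mu> * (2 / \<mu> + 1)" using \<mu> by (intro mult_left_mono) auto
    then have 1: "\<mu> * real k \<ge> 2 + \<mu>" using \<mu> by (simp add: distrib_left)
    have "\<mu> * real k \<le> \<mu> * symbol r k" using \<mu> symbol_ge[OF r] by (intro mult_left_mono) auto
    moreover have "\<mu> * (1 + real k) / 2 = \<mu> / 2 + \<mu> * real k / 2" by (simp add: distrib_left add_divide_distrib)
    ultimately have d1: "\<mu> * (1 + real k) / 2 \<le> \<mu> * symbol r k - 1" using 1 by linarith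
    have d2: "0 < \<mu> * (1 + real k) / 2" using \<mu> by simp
    have "(1 + real k) / (\<mu> * symbol r k - 1) \<le> (1 + real k) / (\<mu> * (1 + real k) / 2)"
      and "0 \<le> (1 + real k) / (\<mu> * symbol r k - 1)"
      by (rule frac_le[OF _ order_refl d2 d1], simp, rule divide_nonneg_nonneg, simp, use d1 d2 in linarith)
    then have "g k \<le> (1 + real k) / (\<mu> * (1 + real k) / 2)"
      unfolding g_def by (simp only: abs_of_nonneg)
    also have "\<dots> = 2 / \<mu>" using \<mu> by (simp add: divide_simps)
    finally show ?thesis by (simp add: add_increasing2 sum_nonneg g_def)
  qed
  then show thesis using that by (auto simp: g_def \<mu>_def)
qed

text \<open>The coefficients of \<open>cos (n t)\<close>, with the weight undone.\<close>

definition kernel_elem :: "nat \<Rightarrow> ell1" where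
  "kernel_elem n = (1 + real n) *\<^sub>R unit_ell1 n"

lemma cos_series_kernel_elem: "cos_series_H0 (kernel_elem n) = cos_even_H0 n"
  by (simp add: kernel_elem_def linear_scale[OF bounded_linear.linear[OF bounded_linear_cos_series]] cos_series_unit)

lemma symbol_op_kernel_elem: "symbol_op (kernel_elem n) = symbol r n *\<^sub>R unit_ell1 n"
  by (simp add: kernel_elem_def blinfun.scaleR_right symbol_op_unit)

lemma linearisation_kernel_elem:
  assumes "1 \<le> n"
  shows "bif_point r n *\<^sub>R symbol_op (kernel_elem n) = incl_op (kernel_elem n)"
  using symbol_ge[OF r, of n] assms
  by (simp add: symbol_op_kernel_elem bif_point_eq) (simp add: kernel_elem_def blinfun.scaleR_right incl_op_unit)

text \<open>A right inverse of \<open>(m, w) \<mapsto> m L c + (\<mu>\<^sub>n L - 1) w\<close>, where \<open>L\<close> is \<open>v \<mapsto> B v'\<close> and \<open>c\<close> is the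
  kernel element. The cokernel direction \<open>cos (n t)\<close> is reached through the parameter \<open>m\<close>
  (transversality), every other cosine through \<open>w\<close>.\<close>

definition bif_inverse :: "nat \<Rightarrow> ell1 \<Rightarrow>\<^sub>L (real \<times> ell1)" where
  "bif_inverse n = lin_ext (\<lambda>k. if k = n then (bif_point r n, 0)
     else (0, ((1 + real k) / (bif_point r n * symbol r k - 1)) *\<^sub>R unit_ell1 k))"

lemma bif_inverse_unit:
  assumes n: "1 \<le> n"
  shows "bif_inverse n (unit_ell1 k) = (if k = n then (bif_point r n, 0)
     else (0, ((1 + real k) / (bif_point r n * symbol r k - 1)) *\<^sub>R unit_ell1 k))"
proof -
  obtain C where C: "\<And>k. \<bar>(1 + real k) / (bif_point r n * symbol r k - 1)\<bar> \<le> C"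
    using resolvent_bounded[OF n] by blast
  then have "0 \<le> C" using order_trans[OF abs_ge_zero] by blast
  then show ?thesis
    unfolding bif_inverse_def
    using C bif_point_pos[OF n]
    by (intro lin_ext_unit[where C = "C + bif_point r n"])
      (auto simp: norm_Pair add_increasing add_increasing2)
qed

lemma bif_inverse_right:
  assumes n: "1 \<le> n"
  shows "fst (bif_inverse n y) *\<^sub>R symbol_op (kernel_elem n)
      + bif_point r n *\<^sub>R symbol_op (snd (bif_inverse n y)) - incl_op (snd (bif_inverse n y)) = y"
proof (rule bounded_linear_ell1_eqI[where a = y and g = "\<lambda>y. y" and f = "\<lambda>y. fst (bif_inverse n y) *\<^sub>R symbol_op (kernel_elem n)
      + bif_point r n *\<^sub>R symbol_op (snd (bif_inverse n y)) - incl_op (snd (bif_inverse n y))"])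
  have snd: "bounded_linear (\<lambda>y. snd (bif_inverse n y))" and fst: "bounded_linear (\<lambda>y. fst (bif_inverse n y))"
    by (rule bounded_linear_snd_comp bounded_linear_fst_comp, rule blinfun.bounded_linear_right)+
  show "bounded_linear (\<lambda>y. fst (bif_inverse n y) *\<^sub>R symbol_op (kernel_elem n)
      + bif_point r n *\<^sub>R symbol_op (snd (bif_inverse n y)) - incl_op (snd (bif_inverse n y)))"
    by (intro bounded_linear_sub bounded_linear_add bounded_linear_scaleR_const bounded_linear_const_scaleR fst
        bounded_linear_compose[OF blinfun.bounded_linear_right snd])
  fix k
  have pos: "symbol r n > 0" using symbol_ge[OF r, of n] n by simp
  show "fst (bif_inverse n (unit_ell1 k)) *\<^sub>R symbol_op (kernel_elem n)
      + bif_point r n *\<^sub>R symbol_op (snd (bif_inverse n (unit_ell1 k)))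
      - incl_op (snd (bif_inverse n (unit_ell1 k))) = unit_ell1 k"
  proof (cases "k = n")
    case True
    then show ?thesis
      using pos by (simp add: bif_inverse_unit[OF n] symbol_op_kernel_elem bif_point_eq)
  next
    case False
    define d where "d = bif_point r n * symbol r k - 1"
    \<comment> \<open>Simplicity of the kernel: only \<open>k = n\<close> is resonant.\<close>
    have "symbol r k \<noteq> symbol r n" using False symbol_inj[OF r] by simp
    then have d: "d \<noteq> 0" using pos by (simp add: d_def bif_point_eq divide_eq_1_iff)
    have inv: "bif_inverse n (unit_ell1 k) = (0, ((1 + real k) / d) *\<^sub>R unit_ell1 k)"
      using False by (simp add: bif_inverse_unit[OF n] d_def)
    have "bif_point r n *\<^sub>R symbol_op (((1 + real k) / d) *\<^sub>R unit_ell1 k) - incl_op (((1 + real k) / d) *\<^sub>R unit_ell1 k)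
        = (bif_point r n * ((1 + real k) / d * (symbol r k / (1 + real k))) - (1 + real k) / d * (1 / (1 + real k))) *\<^sub>R unit_ell1 k"
      by (simp add: blinfun.scaleR_right symbol_op_unit incl_op_unit scaleR_diff_left)
    also have "bif_point r n * ((1 + real k) / d * (symbol r k / (1 + real k))) - (1 + real k) / d * (1 / (1 + real k))
        = (bif_point r n * symbol r k - 1) / d"
      by (simp add: diff_divide_distrib)
    also have "\<dots> = 1" using d by (simp add: d_def)
    finally show ?thesis by (simp add: inv)
  qed
qed simp

text \<open>Inserting \<open>\<mu> = \<mu>\<^sub>n + m\<close> and \<open>v = s (c + w)\<close> in the equation and dividing by \<open>s\<close> leaves
  \<open>m L c + (\<mu>\<^sub>n L - 1) w = (s / 2) Q (c + w, c + w) - m L w\<close>. The right inverse of the left-hand side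
  turns this into a fixed-point problem for \<open>(m, w)\<close> whose right-hand side is flat at the origin.\<close>

definition bif_map :: "nat \<Rightarrow> real \<times> real \<times> ell1 \<Rightarrow> real \<times> ell1" where
  "bif_map n = (\<lambda>(s, m, w). bif_inverse n ((s / 2) *\<^sub>R quad (kernel_elem n + w) (kernel_elem n + w) - m *\<^sub>R symbol_op w))"

definition bif_map' :: "nat \<Rightarrow> real \<times> real \<times> ell1 \<Rightarrow> (real \<times> real \<times> ell1) \<Rightarrow>\<^sub>L (real \<times> ell1)" where
  "bif_map' n = (\<lambda>p. let u = kernel_elem n + snd (snd p); W = snd_blinfun o\<^sub>L snd_blinfun in
     bif_inverse n o\<^sub>L
      ((blinfun_scaleR_left ((1 / 2) *\<^sub>R quad u u) o\<^sub>L fst_blinfun) + fst p *\<^sub>R (quad u o\<^sub>L W)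
       - (blinfun_scaleR_left (symbol_op (snd (snd p))) o\<^sub>L (fst_blinfun o\<^sub>L snd_blinfun))
       - fst (snd p) *\<^sub>R (symbol_op o\<^sub>L W)))"

lemma has_derivative_bif_map: "(bif_map n has_derivative bif_map' n p) (at p)"
proof -
  define Q where "Q p = quad (kernel_elem n + snd (snd p)) (kernel_elem n + snd (snd p))" for p :: "real \<times> real \<times> ell1"
  have Q: "(Q has_derivative (\<lambda>h. 2 *\<^sub>R quad (kernel_elem n + snd (snd p)) (snd (snd h)))) (at p)"
    unfolding Q_def
    by (auto intro!: derivative_eq_intros simp: quad_commute[of "snd (snd _)"] scaleR_2)
  have "((\<lambda>p. bif_inverse n ((fst p / 2) *\<^sub>R Q p - fst (snd p) *\<^sub>R symbol_op (snd (snd p)))) has_derivative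
      (\<lambda>h. bif_inverse n ((fst p / 2) *\<^sub>R (2 *\<^sub>R quad (kernel_elem n + snd (snd p)) (snd (snd h))) + (fst h / 2) *\<^sub>R Q p
        - (fst (snd p) *\<^sub>R symbol_op (snd (snd h)) + fst (snd h) *\<^sub>R symbol_op (snd (snd p)))))) (at p)"
    by (auto intro!: derivative_eq_intros Q)
  moreover have "bif_inverse n ((fst p / 2) *\<^sub>R (2 *\<^sub>R quad (kernel_elem n + snd (snd p)) (snd (snd h))) + (fst h / 2) *\<^sub>R Q p
        - (fst (snd p) *\<^sub>R symbol_op (snd (snd h)) + fst (snd h) *\<^sub>R symbol_op (snd (snd p)))) = bif_map' n p h" for h
    by (simp add: bif_map'_def Let_def Q_def blinfun.bilinear_simps algebra_simps)
  moreover have "bif_map n = (\<lambda>p. bif_inverse n ((fst p / 2) *\<^sub>R Q p - fst (snd p) *\<^sub>R symbol_op (snd (snd p))))"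
    by (auto simp: bif_map_def Q_def fun_eq_iff)
  ultimately show ?thesis by simp
qed

lemma continuous_on_bif_map': "continuous_on UNIV (bif_map' n)"
  unfolding bif_map'_def Let_def by (intro continuous_intros)

lemma bif_map'_0: "bif_map' n (0, 0) (h, k) = (h / 2) *\<^sub>R bif_inverse n (quad (kernel_elem n) (kernel_elem n))"
  by (simp add: bif_map'_def Let_def blinfun.bilinear_simps zero_prod_def)

text \<open>The product \<open>cos\<^sup>2 (n t)\<close> contains only the frequencies 0 and \<open>2 n\<close>, so it has no component in
  the direction \<open>cos (n t)\<close>. This is the reason why the parameter \<open>\<mu>\<close> has no term linear in \<open>s\<close>.\<close>

lemma fst_bif_inverse_quad_kernel:
  assumes n: "1 \<le> n"
  shows "fst (bif_inverse n (quad (kernel_elem n) (kernel_elem n))) = 0"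
proof -
  have "freq_diff n n \<noteq> n" "n + n \<noteq> n" using n by (simp_all add: freq_diff_def)
  then show ?thesis
    by (simp add: kernel_elem_def blinfun.bilinear_simps quad_unit quad_coeff_def bif_inverse_unit[OF n])
qed

lemma fixed_point_solves:
  assumes n: "1 \<le> n" and fp: "(m, w) = bif_map n (s, m, w)"
  shows "babenko_F B (bif_point r n + m, cos_series_H0 (s *\<^sub>R (kernel_elem n + w))) = 0"
proof -
  define u where "u = kernel_elem n + w"
  define y where "y = (s / 2) *\<^sub>R quad u u - m *\<^sub>R symbol_op w"
  have "bif_inverse n y = (m, w)" using fp by (simp add: bif_map_def y_def u_def)
  with bif_inverse_right[OF n, of y]
  have eq: "m *\<^sub>R symbol_op (kernel_elem n) + bif_point r n *\<^sub>R symbol_op w - incl_op w = y" by simp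
  have "(bif_point r n + m) *\<^sub>R symbol_op (s *\<^sub>R u) - incl_op (s *\<^sub>R u) - (1 / 2) *\<^sub>R quad (s *\<^sub>R u) (s *\<^sub>R u)
      = s *\<^sub>R ((bif_point r n *\<^sub>R symbol_op (kernel_elem n) - incl_op (kernel_elem n))
         + (m *\<^sub>R symbol_op (kernel_elem n) + bif_point r n *\<^sub>R symbol_op w - incl_op w) - y)"
    by (simp add: y_def u_def blinfun.bilinear_simps algebra_simps)
  also have "\<dots> = 0" by (simp add: eq linearisation_kernel_elem[OF n])
  finally show ?thesis
    unfolding babenko_F_cos_series u_def[symmetric]
    by (simp add: linear_0[OF linear_cos_series_L2])
qed

end

theorem theorem2:
  fixes r :: real and B :: "L2 \<Rightarrow> L2"
  assumes "0 < r" "r < 1"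
    and "is_babenko_op r B"
  shows "\<forall>n\<ge>1. \<exists>\<epsilon>>0. \<exists>(\<mu> :: real \<Rightarrow> real) (v :: real \<Rightarrow> even_H0).
    (\<forall>s. 0 < \<bar>s\<bar> \<and> \<bar>s\<bar> < \<epsilon> \<longrightarrow> babenko_F B (\<mu> s, v s) = 0) \<and>
    \<mu> 0 = bif_point r n \<and> v 0 = 0 \<and>
    continuous_on {-\<epsilon><..<\<epsilon>} (\<lambda>s. (\<mu> s, v s)) \<and>
    (\<lambda>s. \<mu> s - bif_point r n) \<in> o[at 0](\<lambda>s. s) \<and>
    (\<lambda>s. norm (v s - s *\<^sub>R cos_even_H0 n)) \<in> o[at 0](\<lambda>s. s) \<and>
    (\<lambda>s. (\<mu> s, v s)) C1_differentiable_on {-\<epsilon><..<\<epsilon>}"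
proof (intro allI impI)
  fix n :: nat assume n: "1 \<le> n"
  interpret babenko r B using assms by unfold_locales
  note lin = bounded_linear.linear[OF bounded_linear_cos_series]
  obtain \<epsilon> z z' where \<epsilon>: "\<epsilon> > 0" and z: "\<And>s. \<bar>s\<bar> < \<epsilon> \<Longrightarrow> z s = bif_map n (s, z s)" and z0: "z 0 = 0"
    and z': "\<And>s. \<bar>s\<bar> < \<epsilon> \<Longrightarrow> (z has_vector_derivative z' s) (at s)"
    and z'_cont: "continuous_on {-\<epsilon><..<\<epsilon>} z'" and z'0: "z' 0 = bif_map' n (0, 0) (1, 0)"
  proof (rule C1_fixed_point_curve[OF has_derivative_bif_map continuous_on_bif_map'])
    show "bif_map n (0, 0) = 0"
      by (simp add: bif_map_def blinfun.bilinear_simps zero_prod_def)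
    show "bif_map' n (0, 0) (0, k) = 0" for k by (simp add: bif_map'_0)
  qed (use that in blast)
  \<comment> \<open>The fixed-point curve consists of the corrections of the parameter and of the profile.\<close>
  define m w where "m s = fst (z s)" and "w s = snd (z s)" for s
  define \<mu> where "\<mu> s = bif_point r n + m s" for s
  define v where "v s = cos_series_H0 (s *\<^sub>R (kernel_elem n + w s))" for s
  define v' where "v' s = cos_series_H0 (s *\<^sub>R snd (z' s) + (kernel_elem n + w s))" for s
  have m': "(m has_vector_derivative fst (z' s)) (at s)"
    and w': "(w has_vector_derivative snd (z' s)) (at s)" if "\<bar>s\<bar> < \<epsilon>" for s
    unfolding m_def[abs_def] w_def[abs_def]
    by (rule bounded_linear.has_vector_derivative[OF bounded_linear_fst z'[OF that]]
        bounded_linear.has_vector_derivative[OF bounded_linear_snd z'[OF that]])+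
  have v_deriv: "(v has_vector_derivative v' s) (at s)" if "\<bar>s\<bar> < \<epsilon>" for s
    unfolding v_def[abs_def] v'_def
    by (rule bounded_linear.has_vector_derivative[OF bounded_linear_cos_series])
      (auto intro!: derivative_eq_intros w'[OF that])
  have deriv: "((\<lambda>s. (\<mu> s, v s)) has_vector_derivative (fst (z' s), v' s)) (at s)" if "\<bar>s\<bar> < \<epsilon>" for s
    unfolding \<mu>_def by (intro has_vector_derivative_Pair v_deriv that)
      (auto intro!: derivative_eq_intros m'[OF that])
  have w_cont: "continuous_on {-\<epsilon><..<\<epsilon>} w"
    by (intro continuous_at_imp_continuous_on ballI has_vector_derivative_continuous[OF w']) auto
  have sol: "babenko_F B (\<mu> s, v s) = 0" if "\<bar>s\<bar> < \<epsilon>" for s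
    unfolding \<mu>_def v_def by (rule fixed_point_solves[OF n]) (use z[OF that] in \<open>simp add: m_def w_def\<close>)
  have \<mu>_small: "(\<lambda>s. \<mu> s - bif_point r n) \<in> o[at 0](\<lambda>s. s)"
  proof (rule smalloI_tendsto)
    have "(m has_real_derivative 0) (at 0)"
      using m'[of 0] \<epsilon> by (simp add: z'0 bif_map'_0 fst_bif_inverse_quad_kernel[OF n]
          has_real_derivative_iff_has_vector_derivative)
    then show "((\<lambda>s. (\<mu> s - bif_point r n) / s) \<longlongrightarrow> 0) (at 0)"
      using z0 by (simp add: DERIV_def \<mu>_def m_def)
  qed (simp add: eventually_at_filter)
  have v_small: "(\<lambda>s. norm (v s - s *\<^sub>R cos_even_H0 n)) \<in> o[at 0](\<lambda>s. s)"
  proof (rule smalloI_tendsto)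
    have "v s - s *\<^sub>R cos_even_H0 n = s *\<^sub>R cos_series_H0 (w s)" for s
      by (simp add: v_def linear_scale[OF lin] linear_add[OF lin] cos_series_kernel_elem scaleR_right_distrib)
    then have le: "norm (norm (v s - s *\<^sub>R cos_even_H0 n) / s) \<le> norm (cos_series_H0 (w s))" for s
      by (simp add: abs_mult divide_simps)
    have lim: "((\<lambda>s. norm (cos_series_H0 (w s))) \<longlongrightarrow> 0) (at 0)"
    proof -
      have "isCont w 0" using w'[of 0] \<epsilon> by (intro has_vector_derivative_continuous) auto
      then have "(w \<longlongrightarrow> 0) (at 0)" using z0 by (simp add: isCont_def w_def)
      from bounded_linear.tendsto[OF bounded_linear_cos_series this]
      show ?thesis by (simp add: linear_0[OF lin] tendsto_norm_zero)
    qed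
    show "((\<lambda>s. norm (v s - s *\<^sub>R cos_even_H0 n) / s) \<longlongrightarrow> 0) (at 0)"
      by (rule Lim_null_comparison[OF always_eventually[OF allI[OF le]] lim])
  qed (simp add: eventually_at_filter)
  show "\<exists>\<epsilon>>0. \<exists>(\<mu> :: real \<Rightarrow> real) (v :: real \<Rightarrow> even_H0).
    (\<forall>s. 0 < \<bar>s\<bar> \<and> \<bar>s\<bar> < \<epsilon> \<longrightarrow> babenko_F B (\<mu> s, v s) = 0) \<and>
    \<mu> 0 = bif_point r n \<and> v 0 = 0 \<and>
    continuous_on {-\<epsilon><..<\<epsilon>} (\<lambda>s. (\<mu> s, v s)) \<and>
    (\<lambda>s. \<mu> s - bif_point r n) \<in> o[at 0](\<lambda>s. s) \<and>
    (\<lambda>s. norm (v s - s *\<^sub>R cos_even_H0 n)) \<in> o[at 0](\<lambda>s. s) \<and>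
    (\<lambda>s. (\<mu> s, v s)) C1_differentiable_on {-\<epsilon><..<\<epsilon>}"
  proof (intro exI[of _ \<epsilon>] exI[of _ \<mu>] exI[of _ v] conjI)
    show "\<mu> 0 = bif_point r n" "v 0 = 0"
      by (simp_all add: \<mu>_def m_def z0 v_def linear_0[OF lin])
    show "continuous_on {-\<epsilon><..<\<epsilon>} (\<lambda>s. (\<mu> s, v s))"
      by (intro continuous_at_imp_continuous_on ballI has_vector_derivative_continuous[OF deriv]) auto
    have "continuous_on {-\<epsilon><..<\<epsilon>} (\<lambda>s. (fst (z' s), v' s))"
      unfolding v'_def
      by (intro continuous_intros bounded_linear.continuous_on[OF bounded_linear_cos_series] z'_cont w_cont)
    then show "(\<lambda>s. (\<mu> s, v s)) C1_differentiable_on {-\<epsilon><..<\<epsilon>}"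
      unfolding C1_differentiable_on_def using deriv by (intro exI[of _ "\<lambda>s. (fst (z' s), v' s)"]) auto
  qed (use \<epsilon> sol \<mu>_small v_small in auto)
qed

end
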